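(* Let $s>0$, $v\in\mathbb{N}$, and let $\mathcal{F}=\{\phi_k : k\in\mathbb{Z}\}\cup\{\psi_{j,k} : j\in\mathbb{N},\,k\in\mathbb{Z}\}$ satisfy the assumptions (I)-(V) listed in the context (with this $s$ and with $v$ vanishing moments). Let $f\in\mathcal{C}^0(\mathbb{R})\cap L^\infty(\mathbb{R})$, let $r(f)=\sup\{r>0: f\in B^r_{\infty,\infty}(\mathbb{R})\}$ be its optimal Hölder-Zygmund exponent, and let $\gamma_j=\sup_{k\in\mathbb{Z}}|\langle f,\psi_{j,k}\rangle|$, $j\in\mathbb{N}$. If the limit $$r^*(f)=\lim_{n\to\infty}\log_2\Big(\frac{\gamma_n}{\gamma_{n+1}}\Big)-\frac12$$ exists (with $\gamma_n>0$ for all sufficiently large $n$) and satisfies $0<r^*(f)<\min(s,v)$, then $r^*(f)=r(f)$.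
   Context: $\mathbb{N}=\{1,2,\dots\}$, $\mathbb{N}_0=\mathbb{N}\cup\{0\}$; functions are real-valued on $\mathbb{R}$ and $\langle f,g\rangle=\int_{\mathbb{R}}f(x)g(x)\,dx$. Function spaces. For $s\in\mathbb{N}_0$, $\mathcal{C}^s(\mathbb{R})$ is the space of $s$ times continuously differentiable functions. For $s=\ell+\alpha$, $\ell\in\mathbb{N}_0$, $\alpha\in(0,1)$, $\mathcal{C}^s(\mathbb{R})=\{f\in\mathcal{C}^\ell(\mathbb{R}):\sup_{x\in\mathbb{R},h\neq0}|f^{(\ell)}(x+h)-f^{(\ell)}(x)|/|h|^\alpha<\infty\}$. The norm is $\|f\|_{\mathcal{C}^s}=\sum_{i=0}^{s}\|f^{(i)}\|_{L^\infty}$ for $s\in\mathbb{N}_0$, and $\|f\|_{\mathcal{C}^s}=\sum_{i=0}^{\ell}\|f^{(i)}\|_{L^\infty}+\sup_{x,h\ne0}|f^{(\ell)}(x+h)-f^{(\ell)}(x)|/|h|^\alpha$ for $s=\ell+\alpha$. The Zygmund class $\Lambda(\mathbb{R})$ consists of $f:\mathbb{R}\to\mathbb{R}$ with $\sup_{x\in\mathbb{R},h\ne0}|f(x+h)-2f(x)+f(x-h)|/|h|<\infty$. For $r>0$, $$B^r_{\infty,\infty}(\mathbb{R})=\begin{cases}\mathcal{C}^r(\mathbb{R})\cap L^\infty(\mathbb{R}), & r\notin\mathbb{N},\\ \{f\in\mathcal{C}^{r-1}(\mathbb{R})\cap L^\infty(\mathbb{R}): f^{(r-1)}\in\Lambda(\mathbb{R})\},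 & r\in\mathbb{N}.\end{cases}$$ Assumptions on $\mathcal{F}$ (for given $s>0$, $v\in\mathbb{N}$): (I) $\mathcal{F}$ is a Parseval (normalized) tight frame for $L^2(\mathbb{R})$: $f=\sum_{k}\langle f,\phi_k\rangle\phi_k+\sum_{j\in\mathbb{N}}\sum_{k}\langle f,\psi_{j,k}\rangle\psi_{j,k}$ for all $f\in L^2(\mathbb{R})$. (II) There is $C_{supp}>0$ with $\sup_{k}|\mathrm{supp}(\phi_k)|\le C_{supp}$ and $\sup_k|\mathrm{supp}(\psi_{j,k})|\le C_{supp}2^{-j}$ for all $j\in\mathbb{N}$, where $|\mathrm{supp}(\cdot)|$ is the length of the smallest closed interval containing the support. (III) There is $C_\Gamma>0$ such that for every bounded interval $K\subset\mathbb{R}$ (single points allowed) the sets $\Gamma_0(K)=\{k\in\mathbb{Z}:\mathrm{supp}(\phi_k)\cap K\neq\emptyset\}$ and $\Gamma_j(K)=\{k\in\mathbb{Z}:\mathrm{supp}(\psi_{j,k})\cap K\ne\emptyset\}$, $j\in\mathbb{N}$, satisfy $|\Gamma_j(K)|\le C_\Gamma(2^j|K|+1)$ for all $j\ge0$. (IV) ($v$ vanishing moments) $\int_{\mathbb{R}}x^n\psi_{j,k}(x)\,dx=0$ for $n\in\{0,\dots,v-1\}$, $j\in\mathbb{N}$, $k\in\mathbb{Z}$, and there are points $\{x_{j,k}:j\in\mathbb{N},k\in\mathbb{Z}\}\subset\mathbb{R}$ such that for every $0\le r\le v$ there is $C_{vm,r}>0$ with $\sup_{k}\int_{\mathbb{R}}|x|^r|\psi_{j,k}(x+x_{j,k})|\,dx\le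 C_{vm,r}2^{-j(r+\frac12)}$ for all $j\in\mathbb{N}$. (V) $\mathcal{F}\subset\mathcal{C}^s(\mathbb{R})$ and for every $0\le r\le s$ there is $C_{sm,r}>0$ with $\sup_k\|\phi_k\|_{\mathcal{C}^r}\le C_{sm,r}$ and $\sup_k\|\psi_{j,k}\|_{\mathcal{C}^r}\le C_{sm,r}2^{j(r+\frac12)}$ for all $j\in\mathbb{N}$. *)

theory Defs
  imports "HOL-Analysis.Analysis" "HOL-Probability.Essential_Supremum"
begin

text \<open>Lebesgue spaces on the real line. Functions are honest functions; the spaces are not
  quotiented by almost-everywhere equality.\<close>

definition L2_space :: "(real \<Rightarrow> real) set" where
  "L2_space = {f. f \<in> borel_measurable lebesgue \<and> integrable lebesgue (\<lambda>x. (f x)\<^sup>2)}"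

definition pairing :: "(real \<Rightarrow> real) \<Rightarrow> (real \<Rightarrow> real) \<Rightarrow> real" where
  "pairing f g = (LINT x|lebesgue. f x * g x)"

definition Linf_norm :: "(real \<Rightarrow> real) \<Rightarrow> ennreal" where
  "Linf_norm f = esssup lebesgue (\<lambda>x. ennreal \<bar>f x\<bar>)"

definition Linf_space :: "(real \<Rightarrow> real) set" where
  "Linf_space = {f. f \<in> borel_measurable lebesgue \<and> Linf_norm f < \<infinity>}"

text \<open>Unconditional convergence of a series in \<open>L\<^sup>2\<close>: the squared \<open>L\<^sup>2\<close>-distance between
  \<open>f\<close> and the finite partial sums tends to 0. The distance is an extended nonnegative number,
  so a non-integrable difference counts as infinite distance.\<close>

definition L2_has_sum :: "('i \<Rightarrow> real \<Rightarrow> real) \<Rightarrow> (real \<Rightarrow> real) \<Rightarrow> 'i set \<Rightarrow> bool" where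
  "L2_has_sum u f I \<longleftrightarrow>
     ((\<lambda>F. \<integral>\<^sup>+x. ennreal ((f x - (\<Sum>i\<in>F. u i x))\<^sup>2) \<partial>lebesgue) \<longlongrightarrow> 0)
       (finite_subsets_at_top I)"


definition Ck_space :: "nat \<Rightarrow> (real \<Rightarrow> real) set" where
  "Ck_space l = {f. (\<forall>i<l. \<forall>x. (deriv ^^ i) f differentiable (at x)) \<and>
                    continuous_on UNIV ((deriv ^^ l) f)}"

definition holder_seminorm :: "real \<Rightarrow> (real \<Rightarrow> real) \<Rightarrow> ennreal" where
  "holder_seminorm \<alpha> g =
     (SUP (x, h) \<in> {(x, h). h \<noteq> 0}. ennreal (\<bar>g (x + h) - g x\<bar> / \<bar>h\<bar> powr \<alpha>))"

text \<open>The order \<open>s \<ge> 0\<close> is split as \<open>s = l + \<alpha>\<close> with \<open>l = \<lfloor>s\<rfloor>\<close> and \<open>\<alpha> = frac s\<close>. For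
  natural \<open>s\<close> no boundedness of the function or its derivatives is required.\<close>

definition Cs_space :: "real \<Rightarrow> (real \<Rightarrow> real) set" where
  "Cs_space s = (if s \<in> \<nat> then Ck_space (nat \<lfloor>s\<rfloor>)
     else {f \<in> Ck_space (nat \<lfloor>s\<rfloor>). holder_seminorm (frac s) ((deriv ^^ nat \<lfloor>s\<rfloor>) f) < \<infinity>})"

definition Cs_norm :: "real \<Rightarrow> (real \<Rightarrow> real) \<Rightarrow> ennreal" where
  "Cs_norm s f = (\<Sum>i\<le>nat \<lfloor>s\<rfloor>. Linf_norm ((deriv ^^ i) f)) +
     (if s \<in> \<nat> then 0 else holder_seminorm (frac s) ((deriv ^^ nat \<lfloor>s\<rfloor>) f))"

definition zygmund_class :: "(real \<Rightarrow> real) set" where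
  "zygmund_class = {f. (SUP (x, h) \<in> {(x, h). h \<noteq> 0}.
     ennreal (\<bar>f (x + h) - 2 * f x + f (x - h)\<bar> / \<bar>h\<bar>)) < \<infinity>}"

definition besov_space :: "real \<Rightarrow> (real \<Rightarrow> real) set" where
  "besov_space r = (if r \<notin> \<nat> then Cs_space r \<inter> Linf_space
     else {f \<in> Cs_space (r - 1) \<inter> Linf_space. (deriv ^^ (nat \<lfloor>r\<rfloor> - 1)) f \<in> zygmund_class})"

text \<open>Extended-real valued: \<open>\<infinity>\<close> if \<open>f\<close> has every order, \<open>-\<infinity>\<close> if it has no positive order.\<close>

definition holder_zygmund_exponent :: "(real \<Rightarrow> real) \<Rightarrow> ereal" where
  "holder_zygmund_exponent f = (SUP r \<in> {r. r > 0 \<and> f \<in> besov_space r}. ereal r)"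


definition supp :: "(real \<Rightarrow> real) \<Rightarrow> real set" where
  "supp f = closure {x. f x \<noteq> 0}"

text \<open>Length of the smallest closed interval containing the support (\<open>\<infinity>\<close> if the
  support is unbounded, 0 if it is empty).\<close>

definition supp_length :: "(real \<Rightarrow> real) \<Rightarrow> ennreal" where
  "supp_length f = emeasure lborel ((\<lambda>J. closed J \<and> is_interval J) hull supp f)"

text \<open>A family consists of \<open>\<phi> k\<close> and \<open>\<psi> j k\<close> for integers \<open>k\<close> and \<open>j \<ge> 1\<close>; the functions
  \<open>\<psi> 0 k\<close> are not part of it and are never constrained.\<close>

text \<open>The series over \<open>k\<close>, at scale 0 and at each scale \<open>j\<close>, and the series over \<open>j\<close> all
  converge in \<open>L\<^sup>2\<close>; \<open>g\<close> and \<open>h j\<close> are the sums at the individual scales.\<close>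

definition parseval_frame :: "(int \<Rightarrow> real \<Rightarrow> real) \<Rightarrow> (nat \<Rightarrow> int \<Rightarrow> real \<Rightarrow> real) \<Rightarrow> bool" where
  "parseval_frame \<phi> \<psi> \<longleftrightarrow>
     (\<forall>k. \<phi> k \<in> L2_space) \<and> (\<forall>j\<ge>1. \<forall>k. \<psi> j k \<in> L2_space) \<and>
     (\<forall>f\<in>L2_space. \<exists>g h.
        g \<in> L2_space \<and> (\<forall>j\<ge>1. h j \<in> L2_space) \<and>
        L2_has_sum (\<lambda>k x. pairing f (\<phi> k) * \<phi> k x) g UNIV \<and>
        (\<forall>j\<ge>1. L2_has_sum (\<lambda>k x. pairing f (\<psi> j k) * \<psi> j k x) (h j) UNIV) \<and>
        L2_has_sum h (\<lambda>x. f x - g x) {1..})"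

definition short_supports :: "(int \<Rightarrow> real \<Rightarrow> real) \<Rightarrow> (nat \<Rightarrow> int \<Rightarrow> real \<Rightarrow> real) \<Rightarrow> bool" where
  "short_supports \<phi> \<psi> \<longleftrightarrow> (\<exists>C>0.
     (SUP k. supp_length (\<phi> k)) \<le> ennreal C \<and>
     (\<forall>j\<ge>1. (SUP k. supp_length (\<psi> j k)) \<le> ennreal (C * 2 powr (- real j))))"

definition hits :: "(int \<Rightarrow> real \<Rightarrow> real) \<Rightarrow> (nat \<Rightarrow> int \<Rightarrow> real \<Rightarrow> real) \<Rightarrow> nat \<Rightarrow> real set \<Rightarrow> int set" where
  "hits \<phi> \<psi> j K = {k. supp (if j = 0 then \<phi> k else \<psi> j k) \<inter> K \<noteq> {}}"

definition bounded_overlap :: "(int \<Rightarrow> real \<Rightarrow> real) \<Rightarrow> (nat \<Rightarrow> int \<Rightarrow> real \<Rightarrow> real) \<Rightarrow> bool" where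
  "bounded_overlap \<phi> \<psi> \<longleftrightarrow> (\<exists>C>0. \<forall>K. is_interval K \<and> bounded K \<longrightarrow>
     (\<forall>j. finite (hits \<phi> \<psi> j K) \<and>
          real (card (hits \<phi> \<psi> j K)) \<le> C * (2 ^ j * measure lborel K + 1)))"

text \<open>For \<open>r = 0\<close> the convention \<open>0 powr 0 = 0\<close> changes the integrand only at the single
  point \<open>x = 0\<close>.\<close>

definition vanishing_moments :: "nat \<Rightarrow> (nat \<Rightarrow> int \<Rightarrow> real \<Rightarrow> real) \<Rightarrow> bool" where
  "vanishing_moments v \<psi> \<longleftrightarrow>
     (\<forall>n<v. \<forall>j\<ge>1. \<forall>k. has_bochner_integral lebesgue (\<lambda>x. x ^ n * \<psi> j k x) 0) \<and>
     (\<exists>c :: nat \<Rightarrow> int \<Rightarrow> real. \<forall>r. 0 \<le> r \<and> r \<le> real v \<longrightarrow>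
       (\<exists>C>0. \<forall>j\<ge>1.
          (SUP k. \<integral>\<^sup>+x. ennreal (\<bar>x\<bar> powr r * \<bar>\<psi> j k (x + c j k)\<bar>) \<partial>lebesgue)
            \<le> ennreal (C * 2 powr (- real j * (r + 1/2)))))"

definition smooth_family ::
    "real \<Rightarrow> (int \<Rightarrow> real \<Rightarrow> real) \<Rightarrow> (nat \<Rightarrow> int \<Rightarrow> real \<Rightarrow> real) \<Rightarrow> bool" where
  "smooth_family s \<phi> \<psi> \<longleftrightarrow>
     (\<forall>k. \<phi> k \<in> Cs_space s) \<and> (\<forall>j\<ge>1. \<forall>k. \<psi> j k \<in> Cs_space s) \<and>
     (\<forall>r. 0 \<le> r \<and> r \<le> s \<longrightarrow>
       (\<exists>C>0. (SUP k. Cs_norm r (\<phi> k)) \<le> ennreal C \<and>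
          (\<forall>j\<ge>1. (SUP k. Cs_norm r (\<psi> j k)) \<le> ennreal (C * 2 powr (real j * (r + 1/2))))))"


text \<open>A supremum in the reals: the set is bounded above whenever \<open>f\<close> is bounded and the
  \<open>L\<^sup>1\<close>-norms of the \<open>\<psi> j k\<close> are bounded in \<open>k\<close>, as the case \<open>r = 0\<close> of
  \<open>vanishing_moments\<close> guarantees.\<close>

definition coeff_sup :: "(nat \<Rightarrow> int \<Rightarrow> real \<Rightarrow> real) \<Rightarrow> (real \<Rightarrow> real) \<Rightarrow> nat \<Rightarrow> real" where
  "coeff_sup \<psi> f j = (SUP k. \<bar>pairing f (\<psi> j k)\<bar>)"

end

theory Submission
  imports Defs
begin

text \<open>For non-natural \<open>r\<close> with \<open>0 < r < min s v\<close>, membership of a bounded continuous function in the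
  space of order \<open>r\<close> is, up to an arbitrarily small loss in \<open>r\<close>, the same as the decay
  \<open>2 powr (- j * (r + 1/2))\<close> of the largest coefficient at scale \<open>j\<close>. If the logarithms of consecutive
  ratios of these suprema converge to \<open>rstar + 1/2\<close>, then the suprema decay faster than
  \<open>2 powr (- j * (\<sigma> + 1/2))\<close> for every \<open>\<sigma> < rstar\<close> and more slowly for every \<open>\<sigma> > rstar\<close>
  (\<open>log_ratio_limit_imp_upper_bound\<close>, \<open>log_ratio_limit_imp_no_faster_decay\<close>). The critical order can
  therefore be read off in both directions.

  Smoothness forces decay (\<open>coefficient_decay\<close>): the vanishing moments remove the Taylor polynomial
  of \<open>f\<close> at a point of the support, and the remainder is small because the support is short. The
  Hoelder bound of the right order comes from \<open>besov_space_imp_holder\<close>, whose work lies in the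
  natural orders, where only second differences are controlled, and in orders beyond \<open>v\<close>, which have
  to be lowered first. Both need the intermediate derivatives to be bounded, which follows from
  boundedness of \<open>f\<close> (\<open>derivative_small_point\<close>).

  Decay forces smoothness (\<open>besov_space_if_coefficients_decay\<close>): \<open>f\<close> is the sum of its frame
  expansion, and bounded overlap lets one estimate each scale by its largest term, so that the
  expansion is dominated by a geometric series in the norm of order \<open>r\<close>. Since \<open>f\<close> need not lie in
  \<open>L\<^sup>2\<close>, the expansion has to be justified by localization (\<open>frame_reconstruction\<close>).

  Non-natural orders suffice on both sides, because they are dense and the exponent is a supremum.\<close>

section \<open>Continuous functions and essential bounds\<close>

text \<open>Every pointwise consequence drawn below from an almost-everywhere statement goes through this:
  the set where a closed condition on continuous functions fails is open, and a nonempty open set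
  has positive measure.\<close>

lemma open_AE_avoided_imp_empty:
  fixes U :: "real set"
  assumes "open U" "AE x in lebesgue. x \<notin> U"
  shows "U = {}"
proof -
  have "U \<in> sets lebesgue"
    using assms(1) by auto
  then have "negligible U"
    using assms(2) AE_iff_null_sets[of U lebesgue] negligible_iff_null_sets by auto
  then show ?thesis
    using assms(1) open_not_negligible by blast
qed

lemma continuous_AE_eq_imp_eq:
  fixes g h :: "real \<Rightarrow> real"
  assumes "continuous_on UNIV g" "continuous_on UNIV h" "open K"
    and "AE x in lebesgue. x \<in> K \<longrightarrow> g x = h x" "x \<in> K"
  shows "g x = h x"
proof -
  have "open (K \<inter> {x. g x \<noteq> h x})"
    using assms by (intro open_Int open_Collect_neq) auto
  moreover have "AE x in lebesgue. x \<notin> K \<inter> {x. g x \<noteq> h x}"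
    using assms(4) by eventually_elim auto
  ultimately have "K \<inter> {x. g x \<noteq> h x} = {}"
    by (rule open_AE_avoided_imp_empty)
  then show ?thesis using assms(5) by auto
qed

lemma continuous_imp_lebesgue_measurable:
  fixes g :: "real \<Rightarrow> real"
  assumes "continuous_on UNIV g"
  shows "g \<in> borel_measurable lebesgue"
  using borel_measurable_continuous_onI[OF assms] by (simp add: measurable_completion)

lemma continuous_Linf_norm_le_imp_bounded:
  assumes g: "continuous_on UNIV g" and le: "Linf_norm g \<le> ennreal C" and "C \<ge> 0"
  shows "\<bar>g x\<bar> \<le> C"
proof -
  have "AE x in lebesgue. ennreal \<bar>g x\<bar> \<le> ennreal C"
    using esssup_AE[of "\<lambda>x. ennreal \<bar>g x\<bar>" lebesgue] le
    unfolding Linf_norm_def by (auto elim!: eventually_mono)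
  then have "AE x in lebesgue. x \<notin> {x. C < \<bar>g x\<bar>}"
    by eventually_elim (use \<open>C \<ge> 0\<close> in auto)
  moreover have "open {x. C < \<bar>g x\<bar>}"
    using g by (intro open_Collect_less) (auto intro: continuous_intros)
  ultimately have "{x. C < \<bar>g x\<bar>} = {}"
    using open_AE_avoided_imp_empty by blast
  then show ?thesis by (auto simp: not_less)
qed

lemma continuous_Linf_space_imp_bounded:
  assumes "continuous_on UNIV f" "f \<in> Linf_space"
  obtains M where "M \<ge> 0" "\<And>x. \<bar>f x\<bar> \<le> M"
proof
  have "Linf_norm f < \<infinity>" using assms(2) by (simp add: Linf_space_def)
  then have "Linf_norm f \<le> ennreal (enn2real (Linf_norm f))" by simp
  then show "\<bar>f x\<bar> \<le> enn2real (Linf_norm f)" for x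
    using continuous_Linf_norm_le_imp_bounded[OF assms(1)] by auto
qed auto

section \<open>Hoelder and Zygmund bounds for bounded functions\<close>

lemma Ck_space_has_derivative:
  assumes "f \<in> Ck_space l" "i < l"
  shows "((deriv ^^ i) f has_field_derivative (deriv ^^ Suc i) f x) (at x)"
  using assms by (auto simp: Ck_space_def DERIV_deriv_iff_real_differentiable)

lemma Ck_space_continuous:
  assumes "f \<in> Ck_space l" "i \<le> l"
  shows "continuous_on UNIV ((deriv ^^ i) f)"
proof (cases "i = l")
  case True then show ?thesis using assms by (auto simp: Ck_space_def)
next
  case False
  then show ?thesis using assms
    by (auto simp: Ck_space_def continuous_on_eq_continuous_at
        intro!: differentiable_imp_continuous_within)
qed

lemma Ck_space_antimono: "l \<le> m \<Longrightarrow> Ck_space m \<subseteq> Ck_space l"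
  using Ck_space_continuous[of _ m l] by (auto simp: Ck_space_def)

lemma Cs_space_subset_Ck_space: "Cs_space r \<subseteq> Ck_space (nat \<lfloor>r\<rfloor>)"
  by (auto simp: Cs_space_def)

lemma holder_seminorm_leD:
  assumes "holder_seminorm \<alpha> g \<le> ennreal K" "K \<ge> 0"
  shows "\<bar>g (x + h) - g x\<bar> \<le> K * \<bar>h\<bar> powr \<alpha>"
proof (cases "h = 0")
  case False
  have "ennreal (\<bar>g (x + h) - g x\<bar> / \<bar>h\<bar> powr \<alpha>) \<le> holder_seminorm \<alpha> g"
    unfolding holder_seminorm_def by (rule SUP_upper2[of "(x, h)"]) (use False in auto)
  also note assms(1)
  finally show ?thesis
    using False assms(2) by (simp add: divide_le_eq)
qed auto

lemma holder_seminorm_finiteD: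
  assumes "holder_seminorm \<alpha> g < \<infinity>"
  obtains K where "K \<ge> 0" "\<And>x h. \<bar>g (x + h) - g x\<bar> \<le> K * \<bar>h\<bar> powr \<alpha>"
proof
  have "holder_seminorm \<alpha> g \<le> ennreal (enn2real (holder_seminorm \<alpha> g))"
    using assms by simp
  then show "\<bar>g (x + h) - g x\<bar> \<le> enn2real (holder_seminorm \<alpha> g) * \<bar>h\<bar> powr \<alpha>" for x h
    by (rule holder_seminorm_leD) auto
qed auto

lemma holder_seminorm_finiteI:
  assumes "\<And>x h. \<bar>g (x + h) - g x\<bar> \<le> K * \<bar>h\<bar> powr \<alpha>"
  shows "holder_seminorm \<alpha> g < \<infinity>"
proof -
  have "holder_seminorm \<alpha> g \<le> ennreal K"
    unfolding holder_seminorm_def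
    by (intro SUP_least) (auto intro!: ennreal_leI simp: divide_le_eq assms)
  then show ?thesis using le_less_trans ennreal_less_top by fastforce
qed

lemma zygmund_classD:
  assumes "g \<in> zygmund_class"
  obtains A where "A \<ge> 0" "\<And>x h. \<bar>g (x + h) - 2 * g x + g (x - h)\<bar> \<le> A * \<bar>h\<bar>"
proof
  let ?S = "SUP (x, h) \<in> {(x, h). h \<noteq> 0}. ennreal (\<bar>g (x + h) - 2 * g x + g (x - h)\<bar> / \<bar>h\<bar>)"
  have fin: "?S \<le> ennreal (enn2real ?S)"
    using assms by (simp add: zygmund_class_def)
  show "\<bar>g (x + h) - 2 * g x + g (x - h)\<bar> \<le> enn2real ?S * \<bar>h\<bar>" for x h
  proof (cases "h = 0")
    case False
    have "ennreal (\<bar>g (x + h) - 2 * g x + g (x - h)\<bar> / \<bar>h\<bar>) \<le> ?S"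
      by (rule SUP_upper2[of "(x, h)"]) (use False in auto)
    also note fin
    finally show ?thesis using False by (simp add: divide_le_eq)
  qed auto
qed auto

text \<open>The spaces of Hoelder-Zygmund functions bound only the function and the oscillation of its highest
  derivative, not the derivatives in between. The mean value theorem supplies the missing
  information in a weak form: if \<open>f\<close> is bounded, then each derivative is small somewhere in every
  interval of a fixed length. For the step from \<open>i\<close> to \<open>i + 1\<close>, take a good point in the first
  and one in the last third of the interval; their distance is at least 1.\<close>

lemma derivative_small_point:
  fixes f :: "real \<Rightarrow> real"
  assumes f: "f \<in> Ck_space l" and M: "\<And>x. \<bar>f x\<bar> \<le> M" and "i \<le> l"
  shows "\<exists>\<xi>\<in>{a..a + 3 ^ i}. \<bar>(deriv ^^ i) f \<xi>\<bar> \<le> 2 ^ i * M"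
  using \<open>i \<le> l\<close>
proof (induction i arbitrary: a)
  case 0
  then show ?case using M by (auto intro!: bexI[of _ a])
next
  case (Suc i)
  let ?L = "3 ^ i :: real"
  have L: "?L \<ge> 1" by simp
  obtain p where p: "p \<in> {a..a + ?L}" "\<bar>(deriv ^^ i) f p\<bar> \<le> 2 ^ i * M"
    using Suc by (meson Suc_leD)
  obtain q where q: "q \<in> {a + 2 * ?L..a + 2 * ?L + ?L}" "\<bar>(deriv ^^ i) f q\<bar> \<le> 2 ^ i * M"
    using Suc by (meson Suc_leD)
  (* Good points in the outer thirds have a whole third, of length at least 1, between them. *)
  have pq: "p < q" "q - p \<ge> 1" using p(1) q(1) L unfolding atLeastAtMost_iff by linarith+
  obtain z where z: "p < z" "z < q"
    "(deriv ^^ i) f q - (deriv ^^ i) f p = (q - p) * (deriv ^^ Suc i) f z"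
    using MVT2[OF pq(1), of "(deriv ^^ i) f" "(deriv ^^ Suc i) f"]
      Ck_space_has_derivative[OF f, of i] Suc.prems by auto
  have "\<bar>(deriv ^^ Suc i) f z\<bar> \<le> (q - p) * \<bar>(deriv ^^ Suc i) f z\<bar>"
    using pq mult_right_mono[OF pq(2), of "\<bar>(deriv ^^ Suc i) f z\<bar>"] by simp
  also have "\<dots> = \<bar>(deriv ^^ i) f q - (deriv ^^ i) f p\<bar>"
    unfolding z(3) using pq by (simp add: abs_mult)
  also have "\<dots> \<le> 2 ^ Suc i * M" using p q by simp
  finally show ?case using p q z by (intro bexI[of _ z]) auto
qed

text \<open>Going down one order at a time: a function with bounded derivative that is moderate at some
  point of every interval of fixed length is bounded.\<close>

lemma lower_derivatives_bounded:
  fixes f :: "real \<Rightarrow> real"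
  assumes f: "f \<in> Ck_space l" and M: "\<And>x. \<bar>f x\<bar> \<le> M"
    and B: "\<And>x. \<bar>(deriv ^^ l) f x\<bar> \<le> B" and "i \<le> l"
  shows "\<exists>B. \<forall>x. \<bar>(deriv ^^ i) f x\<bar> \<le> B"
  using \<open>i \<le> l\<close>
proof (induction rule: inc_induct)
  case base
  then show ?case using B by auto
next
  case (step i)
  then obtain D where D: "\<And>x. \<bar>(deriv ^^ Suc i) f x\<bar> \<le> D" by auto
  have "\<bar>(deriv ^^ i) f x\<bar> \<le> 2 ^ i * M + D * 3 ^ i" for x
  proof -
    obtain p where p: "p \<in> {x..x + 3 ^ i}" "\<bar>(deriv ^^ i) f p\<bar> \<le> 2 ^ i * M"
      using derivative_small_point[OF f M, of i x] step by auto
    have "norm ((deriv ^^ i) f p - (deriv ^^ i) f x) \<le> D * norm (p - x)"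
      by (rule field_differentiable_bound[of UNIV _ "(deriv ^^ Suc i) f"])
        (use D Ck_space_has_derivative[OF f] step in auto)
    also have "\<dots> \<le> D * 3 ^ i"
      using p D[of 0] by (intro mult_left_mono) auto
    finally show ?thesis using p by simp
  qed
  then show ?case by blast
qed

text \<open>Let \<open>\<bar>u\<bar>\<close> attain its maximum at \<open>p\<close>, and reflect the endpoint nearest to \<open>p\<close> in \<open>p\<close>. In the second
  difference of these three points one outer value is 0 and the other is at most \<open>\<bar>u p\<bar>\<close>, so
  the term \<open>2 * u p\<close> cannot be compensated.\<close>

lemma zygmund_vanishing_ends:
  fixes u :: "real \<Rightarrow> real"
  assumes cont: "continuous_on {a..b} u" and "u a = 0" "u b = 0" and "A \<ge> 0"
    and Z: "\<And>x h. \<bar>u (x + h) - 2 * u x + u (x - h)\<bar> \<le> A * \<bar>h\<bar>"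
    and x: "x \<in> {a..b}"
  shows "\<bar>u x\<bar> \<le> A * (b - a)"
proof -
  have "\<exists>p\<in>{a..b}. \<forall>y\<in>{a..b}. \<bar>u y\<bar> \<le> \<bar>u p\<bar>"
    by (rule continuous_attains_sup) (use cont x in \<open>auto intro: continuous_intros\<close>)
  then obtain p where p: "p \<in> {a..b}" "\<And>y. y \<in> {a..b} \<Longrightarrow> \<bar>u y\<bar> \<le> \<bar>u p\<bar>" by auto
  define d where "d = min (p - a) (b - p)"
  have d: "0 \<le> d" "d \<le> b - a" using p by (auto simp: d_def)
  have "(u (p - d) = 0 \<and> \<bar>u (p + d)\<bar> \<le> \<bar>u p\<bar>) \<or> (u (p + d) = 0 \<and> \<bar>u (p - d)\<bar> \<le> \<bar>u p\<bar>)"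
  proof (cases "p - a \<le> b - p")
    case True
    then have "d = p - a" by (simp add: d_def)
    then have "p - d = a" "p + d \<in> {a..b}" using True p(1) by auto
    then show ?thesis using p(2)[of "p + d"] assms(2) by simp
  next
    case False
    then have "d = b - p" by (simp add: d_def)
    then have "p + d = b" "p - d \<in> {a..b}" using False p(1) by auto
    then show ?thesis using p(2)[of "p - d"] assms(3) by simp
  qed
  then have "\<bar>u p\<bar> \<le> A * d" using Z[of p d] d by auto
  also have "\<dots> \<le> A * (b - a)" using d \<open>A \<ge> 0\<close> by (intro mult_left_mono) auto
  finally show ?thesis using p(2)[OF x] by linarith
qed

text \<open>Second differences do not see affine functions, so a Zygmund function may grow linearly. Between
  two points where \<open>g\<close> is moderate, subtracting the affine interpolant reduces the claim to a
  function that vanishes at both ends.\<close>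

lemma zygmund_bounded:
  fixes g :: "real \<Rightarrow> real"
  assumes cont: "continuous_on UNIV g" and "A \<ge> 0" "L \<ge> 0"
    and Z: "\<And>x h. \<bar>g (x + h) - 2 * g x + g (x - h)\<bar> \<le> A * \<bar>h\<bar>"
    and pts: "\<And>a. \<exists>p\<in>{a..a + L}. \<bar>g p\<bar> \<le> B"
  shows "\<bar>g x\<bar> \<le> B + A * (2 * L + 2)"
proof -
  obtain p where p: "p \<in> {x - L - 1..x - L - 1 + L}" "\<bar>g p\<bar> \<le> B" using pts by blast
  obtain q where q: "q \<in> {x + 1..x + 1 + L}" "\<bar>g q\<bar> \<le> B" using pts by blast
  have pq: "p < x" "x < q" "q - p \<le> 2 * L + 2" using p q by auto
  define t where "t = (g q - g p) / (q - p)"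
  define u where "u = (\<lambda>y. g y - (g p + t * (y - p)))"
  have tq: "t * (q - p) = g q - g p" using pq by (simp add: t_def)
  have "\<bar>u x\<bar> \<le> A * (q - p)"
  proof (rule zygmund_vanishing_ends[where A = A and u = u and x = x])
    show "continuous_on {p..q} u"
      unfolding u_def using cont by (auto intro!: continuous_intros elim: continuous_on_subset)
    have "u (y + h) - 2 * u y + u (y - h) = g (y + h) - 2 * g y + g (y - h)" for y h
      by (simp add: u_def algebra_simps)
    then show "\<bar>u (y + h) - 2 * u y + u (y - h)\<bar> \<le> A * \<bar>h\<bar>" for y h using Z by simp
  qed (use tq pq \<open>A \<ge> 0\<close> in \<open>auto simp: u_def\<close>)
  moreover have "\<bar>g p + t * (x - p)\<bar> \<le> B"
  proof -
    define w where "w = (x - p) / (q - p)"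
    have w: "0 \<le> w" "w \<le> 1" using pq by (auto simp: w_def)
    have "g p + t * (x - p) = (1 - w) * g p + w * g q"
      by (simp add: t_def w_def algebra_simps diff_divide_distrib)
    also have "\<bar>\<dots>\<bar> \<le> (1 - w) * B + w * B"
      using w p q by (intro order_trans[OF abs_triangle_ineq] add_mono)
        (auto simp: abs_mult intro!: mult_left_mono)
    finally show ?thesis by (simp add: algebra_simps)
  qed
  moreover have "A * (q - p) \<le> A * (2 * L + 2)"
    using pq \<open>A \<ge> 0\<close> by (intro mult_left_mono) auto
  ultimately show ?thesis by (auto simp: u_def)
qed

text \<open>Write \<open>D h = g (x + h) - g x\<close>. The Zygmund condition at \<open>x + h\<close> says that \<open>D h\<close> differs from
  \<open>D (2 * h) / 2\<close> by at most \<open>A * \<bar>h\<bar> / 2\<close>. Halving \<open>D\<close> gains the factor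
  \<open>2 powr (\<beta> - 1) < 1\<close> over the bound at scale \<open>2 * h\<close>, and the slack \<open>\<delta>\<close> absorbs the error term.
  Induction on the number of doublings needed to bring the increment to size 1/2 gives the claim;
  the large increments are controlled by boundedness.\<close>

lemma zygmund_bounded_imp_holder:
  fixes g :: "real \<Rightarrow> real"
  assumes "A \<ge> 0" and Z: "\<And>x h. \<bar>g (x + h) - 2 * g x + g (x - h)\<bar> \<le> A * \<bar>h\<bar>"
    and B: "\<And>x. \<bar>g x\<bar> \<le> B" and \<beta>: "0 < \<beta>" "\<beta> < 1"
  shows "\<exists>K\<ge>0. \<forall>x h. \<bar>g (x + h) - g x\<bar> \<le> K * \<bar>h\<bar> powr \<beta>"
proof -
  (* K must cover increments of size at least 1/2 and satisfy K * 2 powr (\<beta> - 1) + A / 2 \<le> K. *)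
  define \<delta> where "\<delta> = 1 - 2 powr (\<beta> - 1)"
  have \<delta>: "\<delta> > 0" using \<beta> by (simp add: \<delta>_def powr_less_one)
  define K where "K = max (4 * B) (A / (2 * \<delta>))"
  have KB: "4 * B \<le> K" and KA: "A / 2 \<le> K * \<delta>"
    using \<delta> by (auto simp: K_def max_def field_simps)
  have B0: "B \<ge> 0" using B[of 0] by simp
  then have K0: "K \<ge> 0" using KB by simp
  have large: "\<bar>g (x + h) - g x\<bar> \<le> K * \<bar>h\<bar> powr \<beta>" if "\<bar>h\<bar> \<ge> 1/2" for x h
  proof -
    have "1/2 \<le> (1/2) powr \<beta>"
      using \<beta> powr_mono'[of \<beta> 1 "1/2::real"] by simp
    also have "\<dots> \<le> \<bar>h\<bar> powr \<beta>" using that \<beta> by (intro powr_mono2) auto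
    finally have "4 * B * (1/2) \<le> K * \<bar>h\<bar> powr \<beta>"
      using KB B0 by (intro mult_mono) auto
    then show ?thesis using B[of "x + h"] B[of x] by simp
  qed
  have all: "\<bar>g (x + h) - g x\<bar> \<le> K * \<bar>h\<bar> powr \<beta>" if "\<bar>h\<bar> * 2 ^ n \<ge> 1/2" for n x h
    using that
  proof (induction n arbitrary: x h)
    case 0
    then show ?case using large by simp
  next
    case (Suc n)
    show ?case
    proof (cases "\<bar>h\<bar> \<ge> 1/2")
      case False
      have "\<bar>g (x + 2 * h) - g x\<bar> \<le> K * \<bar>2 * h\<bar> powr \<beta>"
        using Suc by (intro Suc.IH) (auto simp: abs_mult mult_ac)
      also have "\<dots> = 2 * (K * 2 powr (\<beta> - 1) * \<bar>h\<bar> powr \<beta>)"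
        by (simp add: abs_mult powr_mult powr_diff)
      finally have 1: "\<bar>g (x + 2 * h) - g x\<bar> \<le> 2 * (K * 2 powr (\<beta> - 1) * \<bar>h\<bar> powr \<beta>)" .
      have h0: "h \<noteq> 0" using Suc.prems by auto
      have "\<bar>h\<bar> powr 1 \<le> \<bar>h\<bar> powr \<beta>"
        using False \<beta> by (intro powr_mono') auto
      then have "A / 2 * \<bar>h\<bar> \<le> K * \<delta> * \<bar>h\<bar> powr \<beta>"
        using KA \<open>A \<ge> 0\<close> h0 by (intro mult_mono) auto
      moreover have "\<bar>g (x + 2 * h) - 2 * g (x + h) + g x\<bar> \<le> A * \<bar>h\<bar>"
        using Z[of "x + h" h] by (simp add: algebra_simps)
      moreover have "K * \<delta> * \<bar>h\<bar> powr \<beta>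
          = K * \<bar>h\<bar> powr \<beta> - K * 2 powr (\<beta> - 1) * \<bar>h\<bar> powr \<beta>"
        by (simp add: \<delta>_def algebra_simps)
      ultimately show ?thesis using 1 by linarith
    qed (use large in auto)
  qed
  have "\<bar>g (x + h) - g x\<bar> \<le> K * \<bar>h\<bar> powr \<beta>" for x h
  proof (cases "h = 0")
    case False
    obtain n where "1 / \<bar>h\<bar> < 2 ^ n" using real_arch_pow[of 2] by auto
    then have "\<bar>h\<bar> * 2 ^ n \<ge> 1/2" using False by (simp add: field_simps)
    then show ?thesis by (rule all)
  qed auto
  then show ?thesis using K0 by blast
qed

lemma bounded_local_holder_imp_holder:
  fixes g :: "real \<Rightarrow> real"
  assumes B: "\<And>x. \<bar>g x\<bar> \<le> B" and "K \<ge> 0" and \<beta>: "0 < \<beta>" "\<beta> \<le> \<alpha>"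
    and H: "\<And>x h. \<bar>g (x + h) - g x\<bar> \<le> K * \<bar>h\<bar> powr \<alpha>"
  shows "\<exists>K\<ge>0. \<forall>x h. \<bar>g (x + h) - g x\<bar> \<le> K * \<bar>h\<bar> powr \<beta>"
proof -
  have B0: "B \<ge> 0" using B[of 0] by simp
  have "\<bar>g (x + h) - g x\<bar> \<le> (K + 2 * B) * \<bar>h\<bar> powr \<beta>" for x h
  proof (cases "\<bar>h\<bar> \<le> 1")
    case True
    have "K * \<bar>h\<bar> powr \<alpha> \<le> (K + 2 * B) * \<bar>h\<bar> powr \<beta>"
      using True \<beta> B0 \<open>K \<ge> 0\<close> by (intro mult_mono powr_mono') auto
    then show ?thesis using H[of x h] by linarith
  next
    case False
    have "2 * B * 1 \<le> (K + 2 * B) * \<bar>h\<bar> powr \<beta>"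
      using False \<beta> B0 \<open>K \<ge> 0\<close> by (intro mult_mono ge_one_powr_ge_zero) auto
    then show ?thesis using B[of "x + h"] B[of x] by linarith
  qed
  then show ?thesis using B0 \<open>K \<ge> 0\<close> by (intro exI[of _ "K + 2 * B"]) auto
qed

text \<open>Let \<open>l\<close> be the highest order of a derivative that \<open>r\<close> provides. The oscillation
  bound for the \<open>l\<close>-th derivative and the existence of points where it is moderate make that
  derivative bounded, hence all lower ones too. If \<open>l = m\<close>, the Hoelder or Zygmund condition at the
  top level gives the claim; if \<open>l > m\<close>, the \<open>m\<close>-th derivative is even Lipschitz.\<close>

lemma besov_space_imp_holder:
  fixes f :: "real \<Rightarrow> real"
  assumes f: "f \<in> besov_space r" and cont: "continuous_on UNIV f"
    and \<beta>: "0 < \<beta>" "\<beta> < 1" and less: "real m + \<beta> < r"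
  shows "f \<in> Ck_space m"
    and "\<exists>K\<ge>0. \<forall>x h. \<bar>(deriv ^^ m) f (x + h) - (deriv ^^ m) f x\<bar> \<le> K * \<bar>h\<bar> powr \<beta>"
proof -
  have "f \<in> Linf_space" using f by (auto simp: besov_space_def split: if_splits)
  then obtain M where M: "\<And>x. \<bar>f x\<bar> \<le> M"
    using continuous_Linf_space_imp_bounded[OF cont] by metis
  have "\<exists>l B. m \<le> l \<and> f \<in> Ck_space l \<and> (\<forall>x. \<bar>(deriv ^^ l) f x\<bar> \<le> B) \<and>
    (l = m \<longrightarrow> (\<exists>K\<ge>0. \<forall>x h. \<bar>(deriv ^^ l) f (x + h) - (deriv ^^ l) f x\<bar> \<le> K * \<bar>h\<bar> powr \<beta>))"
  proof (cases "r \<in> \<nat>")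
    case False
    define l where "l = nat \<lfloor>r\<rfloor>"
    have r: "r = real l + frac r" using less \<beta> by (simp add: l_def frac_def)
    have fl: "f \<in> Ck_space l" and "holder_seminorm (frac r) ((deriv ^^ l) f) < \<infinity>"
      using f False by (auto simp: besov_space_def Cs_space_def l_def)
    then obtain K where K: "K \<ge> 0"
      "\<And>x h. \<bar>(deriv ^^ l) f (x + h) - (deriv ^^ l) f x\<bar> \<le> K * \<bar>h\<bar> powr frac r"
      using holder_seminorm_finiteD by blast
    have B: "\<bar>(deriv ^^ l) f x\<bar> \<le> 2 ^ l * M + K * (3 ^ l) powr frac r" for x
    proof -
      obtain p where p: "p \<in> {x..x + 3 ^ l}" "\<bar>(deriv ^^ l) f p\<bar> \<le> 2 ^ l * M"
        using derivative_small_point[OF fl M, of l x] by auto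
      have "K * \<bar>p - x\<bar> powr frac r \<le> K * (3 ^ l) powr frac r"
        using p K by (intro mult_left_mono powr_mono2) auto
      then show ?thesis using p K(2)[of x "p - x"] by simp
    qed
    have "real m < real l + 1" using r less \<beta> frac_lt_1[of r] by linarith
    then have "m \<le> l" by simp
    moreover have "\<exists>K\<ge>0. \<forall>x h. \<bar>(deriv ^^ l) f (x + h) - (deriv ^^ l) f x\<bar> \<le> K * \<bar>h\<bar> powr \<beta>"
      if "l = m"
      by (rule bounded_local_holder_imp_holder[OF B K(1) \<beta>(1) _ K(2)]) (use r less that in auto)
    ultimately show ?thesis using fl B by blast
  next
    case True
    then obtain n where n: "r = real n" by (auto elim: Nats_cases)
    define l where "l = n - 1"
    have "m < n" using n less \<beta> by linarith
    then have ml: "m \<le> l" and rl: "r - 1 = real l" by (auto simp: l_def n)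
    have fl: "f \<in> Ck_space l" "(deriv ^^ l) f \<in> zygmund_class"
    proof -
      have "nat \<lfloor>r\<rfloor> - 1 = l" by (simp add: n l_def)
      then have "f \<in> Cs_space (real l)" "(deriv ^^ l) f \<in> zygmund_class"
        using f True unfolding besov_space_def rl by auto
      then show "f \<in> Ck_space l" "(deriv ^^ l) f \<in> zygmund_class"
        by (simp_all add: Cs_space_def)
    qed
    then obtain A where A: "A \<ge> 0"
      "\<And>x h. \<bar>(deriv ^^ l) f (x + h) - 2 * (deriv ^^ l) f x + (deriv ^^ l) f (x - h)\<bar> \<le> A * \<bar>h\<bar>"
      using zygmund_classD by blast
    have B: "\<bar>(deriv ^^ l) f x\<bar> \<le> 2 ^ l * M + A * (2 * 3 ^ l + 2)" for x
      by (rule zygmund_bounded[OF Ck_space_continuous[OF fl(1) order_refl] A(1) _ A(2)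
            derivative_small_point[OF fl(1) M order_refl]]) auto
    then show ?thesis
      using ml fl zygmund_bounded_imp_holder[OF A B \<beta>] by blast
  qed
  then obtain l B where l: "m \<le> l" "f \<in> Ck_space l" "\<And>x. \<bar>(deriv ^^ l) f x\<bar> \<le> B"
    "l = m \<Longrightarrow> \<exists>K\<ge>0. \<forall>x h. \<bar>(deriv ^^ l) f (x + h) - (deriv ^^ l) f x\<bar> \<le> K * \<bar>h\<bar> powr \<beta>"
    by blast
  show "f \<in> Ck_space m" using l Ck_space_antimono by blast
  show "\<exists>K\<ge>0. \<forall>x h. \<bar>(deriv ^^ m) f (x + h) - (deriv ^^ m) f x\<bar> \<le> K * \<bar>h\<bar> powr \<beta>"
  proof (cases "l = m")
    case False
    then have ml: "Suc m \<le> l" using l by simp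
    obtain D where D: "\<And>x. \<bar>(deriv ^^ Suc m) f x\<bar> \<le> D"
      using lower_derivatives_bounded[OF l(2) M l(3) ml] by blast
    obtain E where E: "\<And>x. \<bar>(deriv ^^ m) f x\<bar> \<le> E"
      using lower_derivatives_bounded[OF l(2) M l(3) l(1)] by blast
    have lip: "\<bar>(deriv ^^ m) f (x + h) - (deriv ^^ m) f x\<bar> \<le> D * \<bar>h\<bar> powr 1" for x h
    proof -
      have "norm ((deriv ^^ m) f (x + h) - (deriv ^^ m) f x) \<le> D * norm (x + h - x)"
        by (rule field_differentiable_bound[of UNIV _ "(deriv ^^ Suc m) f"])
          (use D Ck_space_has_derivative[OF l(2)] ml in auto)
      then show ?thesis by simp
    qed
    show ?thesis
      by (rule bounded_local_holder_imp_holder[OF E _ \<beta>(1) _ lip]) (use \<beta> D[of 0] in auto)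
  qed (use l in auto)
qed

text \<open>The Lagrange remainder after degree \<open>m - 1\<close> is the term of degree \<open>m\<close> with the \<open>m\<close>-th derivative
  taken at an intermediate point; replacing that point by \<open>c\<close> costs a factor
  \<open>\<bar>x - c\<bar> powr \<beta>\<close> by the Hoelder condition.\<close>

lemma taylor_holder_remainder:
  fixes f :: "real \<Rightarrow> real"
  assumes f: "f \<in> Ck_space m" and "\<beta> > 0"
    and H: "\<And>x h. \<bar>(deriv ^^ m) f (x + h) - (deriv ^^ m) f x\<bar> \<le> K * \<bar>h\<bar> powr \<beta>"
    and "K \<ge> 0"
  shows "\<bar>f x - (\<Sum>i\<le>m. (deriv ^^ i) f c / fact i * (x - c) ^ i)\<bar>
    \<le> K * \<bar>x - c\<bar> powr (real m + \<beta>)"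
proof (cases "m = 0 \<or> x = c")
  case True
  then show ?thesis
  proof
    assume "x = c"
    moreover have "(\<Sum>i\<le>m. (deriv ^^ i) f c / fact i * 0 ^ i) = f c"
      by (simp add: sum.atMost_shift)
    ultimately show ?thesis by simp
  qed (use H[of c "x - c"] in simp)
next
  case False
  let ?P = "\<lambda>m. \<Sum>i<m. (deriv ^^ i) f c / fact i * (x - c) ^ i"
  have "\<exists>t. (if x < c then x < t \<and> t < c else c < t \<and> t < x) \<and>
    f x = ?P m + (deriv ^^ m) f t / fact m * (x - c) ^ m"
    by (rule Taylor[where a = "min x c" and b = "max x c"])
      (use False Ck_space_has_derivative[OF f] in auto)
  then obtain t where t': "if x < c then x < t \<and> t < c else c < t \<and> t < x"
    and tf: "f x = ?P m + (deriv ^^ m) f t / fact m * (x - c) ^ m"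
    by blast
  have t: "\<bar>t - c\<bar> \<le> \<bar>x - c\<bar>"
    using t' by (auto split: if_splits)
  have "f x - (\<Sum>i\<le>m. (deriv ^^ i) f c / fact i * (x - c) ^ i)
      = ((deriv ^^ m) f t - (deriv ^^ m) f c) / fact m * (x - c) ^ m"
    by (subst tf) (simp add: lessThan_Suc_atMost[symmetric] algebra_simps diff_divide_distrib)
  also have "\<bar>\<dots>\<bar> = \<bar>(deriv ^^ m) f t - (deriv ^^ m) f c\<bar> / fact m * \<bar>x - c\<bar> ^ m"
    by (simp add: abs_mult power_abs)
  also have "\<dots> \<le> (K * \<bar>x - c\<bar> powr \<beta>) / 1 * \<bar>x - c\<bar> ^ m"
  proof (intro mult_right_mono frac_le)
    have "K * \<bar>t - c\<bar> powr \<beta> \<le> K * \<bar>x - c\<bar> powr \<beta>"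
      using t \<open>K \<ge> 0\<close> \<open>\<beta> > 0\<close> by (intro mult_left_mono powr_mono2) auto
    then show "\<bar>(deriv ^^ m) f t - (deriv ^^ m) f c\<bar> \<le> K * \<bar>x - c\<bar> powr \<beta>"
      using H[of c "t - c"] by simp
  qed (use \<open>K \<ge> 0\<close> in auto)
  also have "\<dots> = K * \<bar>x - c\<bar> powr (real m + \<beta>)"
    using False by (simp add: powr_add powr_realpow)
  finally show ?thesis .
qed

section \<open>Supports and size of the frame elements\<close>

lemma deriv_eq_0_outside_supp:
  assumes "x \<notin> supp f"
  shows "(deriv ^^ i) f x = 0"
  using assms
proof (induction i arbitrary: x)
  case 0
  then show ?case using closure_subset[of "{x. f x \<noteq> 0}"] by (auto simp: supp_def)
next
  case (Suc i)
  have "((deriv ^^ i) f has_field_derivative 0) (at x)"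
  proof (rule has_field_derivative_transform_within_open)
    show "((\<lambda>x::real. 0::real) has_field_derivative 0) (at x)" by simp
    show "open (- supp f)" unfolding supp_def by (intro open_Compl closed_closure)
  qed (use Suc in auto)
  then show ?case by (simp add: DERIV_imp_deriv)
qed

text \<open>The closed interval spanned by two points of the support lies in the hull, so its length is at most
  the measure of the hull.\<close>

lemma supp_length_leD:
  assumes le: "supp_length f \<le> ennreal d" and "d \<ge> 0" and xy: "x \<in> supp f" "y \<in> supp f"
  shows "\<bar>x - y\<bar> \<le> d"
proof -
  have *: "b - a \<le> d" if ab: "a \<le> b" "a \<in> supp f" "b \<in> supp f" for a b
  proof -
    let ?H = "(\<lambda>J. closed J \<and> is_interval J) hull supp f"
    have "{a..b} \<subseteq> ?H"
      using ab unfolding hull_def by (auto simp: subset_eq) (meson mem_is_interval_1_I)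
    moreover have "closed ?H" unfolding hull_def by (intro closed_Inter) auto
    ultimately have "emeasure lborel {a..b} \<le> supp_length f"
      unfolding supp_length_def by (intro emeasure_mono) auto
    also note le
    finally show ?thesis using ab \<open>d \<ge> 0\<close> by simp
  qed
  show ?thesis using *[of x y] *[of y x] xy by (cases "x \<le> y") auto
qed

lemma integral_le_diameter_times_bound:
  fixes F :: "real \<Rightarrow> real"
  assumes "\<And>x. \<bar>F x\<bar> \<le> B" "\<And>x. x \<notin> S \<Longrightarrow> F x = 0"
    and diam: "\<And>x y. x \<in> S \<Longrightarrow> y \<in> S \<Longrightarrow> \<bar>x - y\<bar> \<le> d" and "B \<ge> 0" "d \<ge> 0"
  shows "\<bar>LINT x|lebesgue. F x\<bar> \<le> 2 * d * B"
proof (cases "S = {} \<or> \<not> integrable lebesgue F")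
  case True
  then show ?thesis using assms by (auto simp: not_integrable_integral_eq)
next
  case False
  then obtain p where p: "p \<in> S" by auto
  have "ennreal (norm (LINT x|lebesgue. F x)) \<le> (\<integral>\<^sup>+x. norm (F x) \<partial>lebesgue)"
    using False by (intro integral_norm_bound_ennreal) auto
  also have "\<dots> \<le> (\<integral>\<^sup>+x. ennreal B * indicator {p - d..p + d} x \<partial>lebesgue)"
  proof (intro nn_integral_mono)
    fix x
    show "ennreal (norm (F x)) \<le> ennreal B * indicator {p - d..p + d} x"
      using assms(1,2)[of x] diam[OF p, of x]
      by (cases "x \<in> S") (auto split: split_indicator intro!: ennreal_leI)
  qed
  also have "\<dots> = ennreal B * ennreal (2 * d)"
    using \<open>d \<ge> 0\<close> by (subst nn_integral_cmult_indicator) auto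
  also have "\<dots> = ennreal (2 * d * B)"
    using \<open>d \<ge> 0\<close> \<open>B \<ge> 0\<close> by (simp add: ennreal_mult[symmetric] mult.commute)
  finally show ?thesis using \<open>d \<ge> 0\<close> \<open>B \<ge> 0\<close> by simp
qed

lemma Cs_norm_leD_deriv:
  assumes f: "f \<in> Ck_space (nat \<lfloor>r\<rfloor>)" and le: "Cs_norm r f \<le> ennreal K" and "K \<ge> 0"
    and i: "i \<le> nat \<lfloor>r\<rfloor>"
  shows "\<bar>(deriv ^^ i) f x\<bar> \<le> K"
proof (rule continuous_Linf_norm_le_imp_bounded[where g = "(deriv ^^ i) f"])
  have "Linf_norm ((deriv ^^ i) f) \<le> (\<Sum>i\<le>nat \<lfloor>r\<rfloor>. Linf_norm ((deriv ^^ i) f))"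
    using i by (intro member_le_sum) auto
  also have "\<dots> \<le> Cs_norm r f" by (simp add: Cs_norm_def)
  finally show "Linf_norm ((deriv ^^ i) f) \<le> ennreal K" using le by (rule order_trans)
qed (use Ck_space_continuous[OF f i] \<open>K \<ge> 0\<close> in auto)

lemma Cs_norm_leD_holder:
  assumes "r \<notin> \<nat>" and le: "Cs_norm r f \<le> ennreal K" and "K \<ge> 0"
  shows "\<bar>(deriv ^^ nat \<lfloor>r\<rfloor>) f (x + h) - (deriv ^^ nat \<lfloor>r\<rfloor>) f x\<bar> \<le> K * \<bar>h\<bar> powr frac r"
proof (rule holder_seminorm_leD)
  have "holder_seminorm (frac r) ((deriv ^^ nat \<lfloor>r\<rfloor>) f) \<le> Cs_norm r f"
    using assms(1) by (simp add: Cs_norm_def)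
  then show "holder_seminorm (frac r) ((deriv ^^ nat \<lfloor>r\<rfloor>) f) \<le> ennreal K"
    using le by (rule order_trans)
qed fact

text \<open>Both kinds of frame elements under one index, with scale 0 for the \<open>\<phi> k\<close>. The weights in the
  size and support conditions equal 1 at \<open>j = 0\<close>, so each of these conditions becomes a single
  estimate over all scales.\<close>

definition atom :: "(int \<Rightarrow> real \<Rightarrow> real) \<Rightarrow> (nat \<Rightarrow> int \<Rightarrow> real \<Rightarrow> real) \<Rightarrow> nat \<Rightarrow> int \<Rightarrow> real \<Rightarrow> real"
  where "atom \<phi> \<psi> j k = (if j = 0 then \<phi> k else \<psi> j k)"

lemma atom_Cs_norm_bound:
  assumes "smooth_family s \<phi> \<psi>" "0 \<le> r" "r \<le> s"
  obtains C where "C > 0"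
    "\<And>j k. Cs_norm r (atom \<phi> \<psi> j k) \<le> ennreal (C * 2 powr (real j * (r + 1/2)))"
proof -
  obtain C where C: "C > 0" "(SUP k. Cs_norm r (\<phi> k)) \<le> ennreal C"
    "\<And>j. j \<ge> 1 \<Longrightarrow> (SUP k. Cs_norm r (\<psi> j k)) \<le> ennreal (C * 2 powr (real j * (r + 1/2)))"
    using assms by (auto simp: smooth_family_def)
  have "Cs_norm r (atom \<phi> \<psi> j k) \<le> ennreal (C * 2 powr (real j * (r + 1/2)))" for j k
    using C(2) C(3)[of j] by (auto simp: atom_def SUP_le_iff)
  then show ?thesis using C(1) that by blast
qed

lemma atom_smooth:
  assumes "smooth_family s \<phi> \<psi>" "r \<le> s"
  shows "atom \<phi> \<psi> j k \<in> Ck_space (nat \<lfloor>r\<rfloor>)"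
proof -
  have "atom \<phi> \<psi> j k \<in> Cs_space s"
    using assms by (auto simp: smooth_family_def atom_def)
  moreover have "nat \<lfloor>r\<rfloor> \<le> nat \<lfloor>s\<rfloor>" using assms(2) by (intro nat_mono floor_mono)
  ultimately show ?thesis using Cs_space_subset_Ck_space Ck_space_antimono by blast
qed

lemma atom_supp_diameter:
  assumes "short_supports \<phi> \<psi>"
  obtains C where "C > 0"
    "\<And>j k x y. x \<in> supp (atom \<phi> \<psi> j k) \<Longrightarrow> y \<in> supp (atom \<phi> \<psi> j k) \<Longrightarrow>
      \<bar>x - y\<bar> \<le> C * 2 powr (- real j)"
proof -
  obtain C where C: "C > 0" "(SUP k. supp_length (\<phi> k)) \<le> ennreal C"
    "\<And>j. j \<ge> 1 \<Longrightarrow> (SUP k. supp_length (\<psi> j k)) \<le> ennreal (C * 2 powr (- real j))"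
    using assms by (auto simp: short_supports_def)
  have "supp_length (atom \<phi> \<psi> j k) \<le> ennreal (C * 2 powr (- real j))" for j k
    using C(2) C(3)[of j] by (auto simp: atom_def SUP_le_iff)
  then have "\<bar>x - y\<bar> \<le> C * 2 powr (- real j)"
    if "x \<in> supp (atom \<phi> \<psi> j k)" "y \<in> supp (atom \<phi> \<psi> j k)" for j k x y
    using supp_length_leD that C(1) by fastforce
  then show ?thesis using C(1) that by blast
qed

section \<open>Decay of the coefficients of a smooth function\<close>

text \<open>The binomial formula writes a moment about \<open>c\<close> as a combination of moments about 0.\<close>

lemma vanishing_moments_shifted:
  assumes "\<And>n. n < v \<Longrightarrow> has_bochner_integral lebesgue (\<lambda>x. x ^ n * g x) 0" and "i < v"
  shows "has_bochner_integral lebesgue (\<lambda>x. (x - c) ^ i * g x) (0::real)"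
proof -
  have "has_bochner_integral lebesgue
      (\<lambda>x. \<Sum>n\<le>i. (of_nat (i choose n) * (- c) ^ (i - n)) * (x ^ n * g x))
      (\<Sum>n\<le>i. (of_nat (i choose n) * (- c) ^ (i - n)) * 0)"
    using assms by (intro has_bochner_integral_sum has_bochner_integral_mult_right) auto
  moreover have "(\<Sum>n\<le>i. (of_nat (i choose n) * (- c) ^ (i - n)) * (x ^ n * g x)) = (x - c) ^ i * g x"
    for x
    using binomial_ring[of x "- c" i] by (simp add: sum_distrib_right sum_distrib_left mult_ac)
  ultimately show ?thesis by simp
qed

text \<open>This is the direct half of the characterization. Subtract from \<open>f\<close> its Taylor polynomial of degree
  \<open>m < v\<close> at a point \<open>c\<close> of the support of \<open>\<psi> j k\<close>; the pairing does not change. On the support,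
  whose diameter is of order \<open>2 powr (- j)\<close>, the remainder is of order \<open>2 powr (- j * (m + \<beta>))\<close>, and
  \<open>\<psi> j k\<close> is at most of order \<open>2 powr (j / 2)\<close> on a set of length of order \<open>2 powr (- j)\<close>.\<close>

lemma coefficient_decay:
  fixes f :: "real \<Rightarrow> real"
  assumes short: "short_supports \<phi> \<psi>" and vm: "vanishing_moments v \<psi>"
    and smooth: "smooth_family s \<phi> \<psi>" and "s > 0"
    and f: "f \<in> Ck_space m" and "m < v" and \<beta>: "\<beta> > 0"
    and K: "K \<ge> 0" "\<And>x h. \<bar>(deriv ^^ m) f (x + h) - (deriv ^^ m) f x\<bar> \<le> K * \<bar>h\<bar> powr \<beta>"
    and M: "\<And>x. \<bar>f x\<bar> \<le> M"
  obtains C where "C > 0"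
    "\<And>j k. j \<ge> 1 \<Longrightarrow> \<bar>pairing f (\<psi> j k)\<bar> \<le> C * 2 powr (- (real j * (real m + \<beta> + 1/2)))"
proof -
  obtain L where L: "L > 0" "\<And>j k x y. x \<in> supp (atom \<phi> \<psi> j k) \<Longrightarrow>
      y \<in> supp (atom \<phi> \<psi> j k) \<Longrightarrow> \<bar>x - y\<bar> \<le> L * 2 powr (- real j)"
    using atom_supp_diameter[OF short] by blast
  obtain C where C: "C > 0"
    "\<And>j k. Cs_norm 0 (atom \<phi> \<psi> j k) \<le> ennreal (C * 2 powr (real j * (0 + 1/2)))"
    using atom_Cs_norm_bound[OF smooth, of 0] \<open>s > 0\<close> by auto
  have bound: "\<bar>pairing f (\<psi> j k)\<bar>
      \<le> (2 * K * C * L powr (real m + \<beta> + 1) + 1) * 2 powr (- (real j * (real m + \<beta> + 1/2)))"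
    if "j \<ge> 1" for j k
  proof -
    define g where "g = \<psi> j k"
    have g: "g = atom \<phi> \<psi> j k" using that by (simp add: g_def atom_def)
    define d where "d = L * 2 powr (- real j)"
    define b where "b = C * 2 powr (real j / 2)"
    have d0: "d > 0" and b0: "b > 0" using L C by (auto simp: d_def b_def)
    have gb: "\<bar>g x\<bar> \<le> b" for x
      using Cs_norm_leD_deriv[OF _ C(2), of j k 0 x] atom_smooth[OF smooth, of 0 j k] \<open>s > 0\<close> C(1)
      by (simp add: g b_def)
    (* For an empty support c is arbitrary, and every estimate on the support holds vacuously. *)
    define c where "c = (SOME c. c \<in> supp g)"
    have c: "\<bar>x - c\<bar> \<le> d" if "x \<in> supp g" for x
      using L(2)[of x j k c] that someI[of "\<lambda>c. c \<in> supp g" x] unfolding d_def c_def g by blast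
    have moments: "has_bochner_integral lebesgue (\<lambda>x. x ^ n * g x) 0" if "n < v" for n
      using vm that \<open>j \<ge> 1\<close> by (auto simp: vanishing_moments_def g_def)
    define P where "P = (\<lambda>x. \<Sum>i\<le>m. (deriv ^^ i) f c / fact i * (x - c) ^ i)"
    have "has_bochner_integral lebesgue
        (\<lambda>x. \<Sum>i\<le>m. ((deriv ^^ i) f c / fact i) * ((x - c) ^ i * g x))
        (\<Sum>i\<le>m. (deriv ^^ i) f c / fact i * 0)"
      by (intro has_bochner_integral_sum has_bochner_integral_mult_right
          vanishing_moments_shifted[where v = v]) (use moments \<open>m < v\<close> in auto)
    then have P: "has_bochner_integral lebesgue (\<lambda>x. P x * g x) 0"
      by (simp add: P_def sum_distrib_right mult.assoc)
    have gi: "integrable lebesgue g"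
      using moments[of 0] \<open>m < v\<close> by (auto simp: has_bochner_integral_iff)
    have "integrable lebesgue (\<lambda>x. f x * g x)"
    proof (rule Bochner_Integration.integrable_bound)
      show "integrable lebesgue (\<lambda>x. M * g x)" using gi by simp
      have "f \<in> borel_measurable lebesgue"
        using continuous_imp_lebesgue_measurable Ck_space_continuous[OF f, of 0] by simp
      then show "(\<lambda>x. f x * g x) \<in> borel_measurable lebesgue"
        using borel_measurable_integrable[OF gi] by (rule borel_measurable_times)
      have "norm (f x * g x) \<le> norm (M * g x)" for x
        unfolding norm_mult using M[of x] by (intro mult_right_mono) auto
      then show "AE x in lebesgue. norm (f x * g x) \<le> norm (M * g x)" by simp
    qed
    then have "pairing f g = (LINT x|lebesgue. f x * g x - P x * g x)"
      using P unfolding pairing_def has_bochner_integral_iff by simp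
    also have "\<bar>\<dots>\<bar> \<le> 2 * d * (K * d powr (real m + \<beta>) * b)"
    proof (rule integral_le_diameter_times_bound[where S = "supp g"])
      show outside: "f x * g x - P x * g x = 0" if "x \<notin> supp g" for x
        using deriv_eq_0_outside_supp[of x g 0] that by simp
      show "\<bar>f x * g x - P x * g x\<bar> \<le> K * d powr (real m + \<beta>) * b" for x
      proof (cases "x \<in> supp g")
        case True
        have "\<bar>f x - P x\<bar> \<le> K * \<bar>x - c\<bar> powr (real m + \<beta>)"
          unfolding P_def by (rule taylor_holder_remainder[OF f \<beta> K(2,1)])
        also have "\<dots> \<le> K * d powr (real m + \<beta>)"
          using c[OF True] K(1) \<beta> by (intro mult_left_mono powr_mono2) auto
        finally have "\<bar>f x - P x\<bar> * \<bar>g x\<bar> \<le> K * d powr (real m + \<beta>) * b"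
          using gb[of x] K(1) by (intro mult_mono) auto
        then show ?thesis by (simp add: abs_mult[symmetric] left_diff_distrib)
      next
        case False
        show ?thesis unfolding outside[OF False] using K(1) b0 by simp
      qed
      show "\<bar>x - y\<bar> \<le> d" if "x \<in> supp g" "y \<in> supp g" for x y
        using that unfolding g d_def by (rule L(2))
    qed (use d0 K(1) b0 in auto)
    also have "2 * d * (K * d powr (real m + \<beta>) * b) = 2 * K * b * d powr (real m + \<beta> + 1)"
      using d0 by (simp add: powr_add)
    also have "d powr (real m + \<beta> + 1)
        = L powr (real m + \<beta> + 1) * 2 powr (- real j * (real m + \<beta> + 1))"
      using L(1) by (simp add: d_def powr_mult powr_powr)
    also have "2 * K * b * (L powr (real m + \<beta> + 1) * 2 powr (- real j * (real m + \<beta> + 1)))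
        = 2 * K * C * L powr (real m + \<beta> + 1) * (2 powr (real j / 2) * 2 powr (- real j * (real m + \<beta> + 1)))"
      by (simp add: b_def)
    also have "2 powr (real j / 2) * 2 powr (- real j * (real m + \<beta> + 1))
        = 2 powr (- (real j * (real m + \<beta> + 1/2)))"
      unfolding powr_add[symmetric] by (rule arg_cong[where f = "\<lambda>t. 2 powr t"], simp add: field_simps)
    also have "2 * K * C * L powr (real m + \<beta> + 1) * 2 powr (- (real j * (real m + \<beta> + 1/2)))
        \<le> (2 * K * C * L powr (real m + \<beta> + 1) + 1) * 2 powr (- (real j * (real m + \<beta> + 1/2)))"
      by (rule mult_right_mono) simp_all
    finally show ?thesis unfolding g_def .
  qed
  have "0 \<le> 2 * K * C * L powr (real m + \<beta> + 1)"
    using K(1) C(1) by simp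
  then have "2 * K * C * L powr (real m + \<beta> + 1) + 1 > 0"
    by linarith
  then show ?thesis using bound by (rule that)
qed

section \<open>Locally finite superpositions\<close>

text \<open>For a locally finite family, summing only over the indices whose support contains \<open>x\<close> makes the
  sum finite at every point; near a given point it coincides with the sum over one fixed finite index set, so the \<open>i\<close>-th
  derivative of the superposition is obtained by changing \<open>i\<close>.\<close>

definition level_sum :: "(int \<Rightarrow> real) \<Rightarrow> (int \<Rightarrow> real \<Rightarrow> real) \<Rightarrow> nat \<Rightarrow> real \<Rightarrow> real" where
  "level_sum c \<theta> i x = (\<Sum>k | x \<in> supp (\<theta> k). c k * (deriv ^^ i) (\<theta> k) x)"

lemma level_sum_eq_sum:
  assumes "finite H" "\<And>k. x \<in> supp (\<theta> k) \<Longrightarrow> k \<in> H"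
  shows "level_sum c \<theta> i x = (\<Sum>k\<in>H. c k * (deriv ^^ i) (\<theta> k) x)"
  unfolding level_sum_def
proof (rule sum.mono_neutral_left)
  show "\<forall>k\<in>H - {k. x \<in> supp (\<theta> k)}. c k * (deriv ^^ i) (\<theta> k) x = 0"
    by (simp add: deriv_eq_0_outside_supp)
qed (use assms in auto)

lemma level_sum_eq_sum_on_interval:
  assumes "finite {k. supp (\<theta> k) \<inter> {a..b} \<noteq> {}}" "x \<in> {a..b}"
  shows "level_sum c \<theta> i x = (\<Sum>k | supp (\<theta> k) \<inter> {a..b} \<noteq> {}. c k * (deriv ^^ i) (\<theta> k) x)"
proof (rule level_sum_eq_sum[OF assms(1)])
  show "k \<in> {k. supp (\<theta> k) \<inter> {a..b} \<noteq> {}}" if "x \<in> supp (\<theta> k)" for k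
    using that assms(2) by blast
qed

text \<open>At all points of an open interval around \<open>x\<close> the sum can be taken over one finite index set, because
  an element and its derivatives vanish off the support.\<close>

lemma level_sum_has_derivative:
  assumes fin: "\<And>a b. finite {k. supp (\<theta> k) \<inter> {a..b} \<noteq> {}}"
    and smooth: "\<And>k. \<theta> k \<in> Ck_space l" and "i < l"
  shows "(level_sum c \<theta> i has_field_derivative level_sum c \<theta> (Suc i) x) (at x)"
proof -
  let ?H = "{k. supp (\<theta> k) \<inter> {x - 1..x + 1} \<noteq> {}}"
  have "((\<lambda>y. \<Sum>k\<in>?H. c k * (deriv ^^ i) (\<theta> k) y) has_field_derivative
      (\<Sum>k\<in>?H. c k * (deriv ^^ Suc i) (\<theta> k) x)) (at x)"
    by (intro DERIV_sum DERIV_cmult Ck_space_has_derivative[OF smooth \<open>i < l\<close>])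
  then have "(level_sum c \<theta> i has_field_derivative
      (\<Sum>k\<in>?H. c k * (deriv ^^ Suc i) (\<theta> k) x)) (at x)"
  proof (rule has_field_derivative_transform_within_open[where S = "{x - 1<..<x + 1}"])
    show "(\<Sum>k\<in>?H. c k * (deriv ^^ i) (\<theta> k) y) = level_sum c \<theta> i y" if "y \<in> {x - 1<..<x + 1}" for y
      using that by (intro level_sum_eq_sum_on_interval[symmetric] fin) auto
  qed auto
  moreover have "level_sum c \<theta> (Suc i) x = (\<Sum>k\<in>?H. c k * (deriv ^^ Suc i) (\<theta> k) x)"
    by (intro level_sum_eq_sum_on_interval fin) auto
  ultimately show ?thesis by (simp only:)
qed

lemma level_sum_continuous:
  assumes fin: "\<And>a b. finite {k. supp (\<theta> k) \<inter> {a..b} \<noteq> {}}"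
    and smooth: "\<And>k. \<theta> k \<in> Ck_space l" and "i \<le> l"
  shows "continuous_on UNIV (level_sum c \<theta> i)"
proof -
  have "continuous (at x) (level_sum c \<theta> i)" for x
  proof -
    let ?H = "{k. supp (\<theta> k) \<inter> {x - 1..x + 1} \<noteq> {}}"
    have "continuous_on {x - 1<..<x + 1} (\<lambda>y. \<Sum>k\<in>?H. c k * (deriv ^^ i) (\<theta> k) y)"
      by (intro continuous_on_sum continuous_on_mult_left
          continuous_on_subset[OF Ck_space_continuous[OF smooth \<open>i \<le> l\<close>]]) auto
    moreover have eq: "level_sum c \<theta> i y = (\<Sum>k\<in>?H. c k * (deriv ^^ i) (\<theta> k) y)"
      if "y \<in> {x - 1<..<x + 1}" for y
      using that by (intro level_sum_eq_sum_on_interval fin) auto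
    ultimately have "continuous_on {x - 1<..<x + 1} (level_sum c \<theta> i)"
      by (simp only: continuous_on_cong[OF refl eq])
    then show ?thesis by (simp add: continuous_on_eq_continuous_at)
  qed
  then show ?thesis by (simp add: continuous_on_eq_continuous_at)
qed

lemma level_sum_bound:
  assumes "finite {k. x \<in> supp (\<theta> k)}" "real (card {k. x \<in> supp (\<theta> k)}) \<le> N"
    and A: "\<And>k. \<bar>c k * (deriv ^^ i) (\<theta> k) x\<bar> \<le> A"
  shows "\<bar>level_sum c \<theta> i x\<bar> \<le> N * A"
proof -
  have "A \<ge> 0" using A[of 0] by linarith
  have "\<bar>level_sum c \<theta> i x\<bar> \<le> real (card {k. x \<in> supp (\<theta> k)}) * A"
    unfolding level_sum_def using A by (intro order_trans[OF sum_abs] sum_bounded_above) auto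
  also have "\<dots> \<le> N * A" using assms(2) \<open>A \<ge> 0\<close> by (rule mult_right_mono)
  finally show ?thesis .
qed

text \<open>At most \<open>2 * N\<close> indices are active at \<open>x\<close> or at \<open>y\<close>, whatever the distance of the
  two points, so a Hoelder bound obtained from this covers all increments.\<close>

lemma level_sum_difference_bound:
  assumes "\<And>x. finite {k. x \<in> supp (\<theta> k)}" "\<And>x. real (card {k. x \<in> supp (\<theta> k)}) \<le> N"
    and A: "\<And>k. \<bar>c k * ((deriv ^^ i) (\<theta> k) y - (deriv ^^ i) (\<theta> k) x)\<bar> \<le> A"
  shows "\<bar>level_sum c \<theta> i y - level_sum c \<theta> i x\<bar> \<le> 2 * N * A"
proof -
  let ?H = "{k. x \<in> supp (\<theta> k)} \<union> {k. y \<in> supp (\<theta> k)}"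
  have "A \<ge> 0" using A[of 0] by linarith
  have fin: "finite ?H" using assms(1) by simp
  have eq: "level_sum c \<theta> i y - level_sum c \<theta> i x
      = (\<Sum>k\<in>?H. c k * ((deriv ^^ i) (\<theta> k) y - (deriv ^^ i) (\<theta> k) x))"
    by (subst (1 2) level_sum_eq_sum[OF fin]) (auto simp: sum_subtractf right_diff_distrib)
  have "\<bar>level_sum c \<theta> i y - level_sum c \<theta> i x\<bar> \<le> real (card ?H) * A"
    unfolding eq using A by (intro order_trans[OF sum_abs] sum_bounded_above) auto
  also have "\<dots> \<le> 2 * N * A"
  proof (rule mult_right_mono[OF _ \<open>A \<ge> 0\<close>])
    have "real (card ?H) \<le> real (card {k. x \<in> supp (\<theta> k)} + card {k. y \<in> supp (\<theta> k)})"
      by (rule of_nat_mono[OF card_Un_le])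
    also have "\<dots> \<le> N + N"
      unfolding of_nat_add by (rule add_mono[OF assms(2) assms(2)])
    finally show "real (card ?H) \<le> 2 * N" unfolding mult_2 .
  qed
  finally show ?thesis .
qed

section \<open>Regularity of a multiscale superposition\<close>

text \<open>At most \<open>N\<close> elements of each scale overlap at a point, and each weighted element of scale \<open>j\<close>
  has derivatives up to order \<open>l\<close> bounded by \<open>A j\<close>. Since \<open>A\<close> is summable, the sums over the scales
  converge uniformly together with their derivatives, and a Hoelder bound that is uniform
  within each scale passes to the whole sum.\<close>

context
  fixes c :: "nat \<Rightarrow> int \<Rightarrow> real" and \<theta> :: "nat \<Rightarrow> int \<Rightarrow> real \<Rightarrow> real"
    and l :: nat and N :: real and A :: "nat \<Rightarrow> real"
  assumes fin: "\<And>j a b. finite {k. supp (\<theta> j k) \<inter> {a..b} \<noteq> {}}"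
    and overlap: "\<And>j x. real (card {k. x \<in> supp (\<theta> j k)}) \<le> N"
    and smooth: "\<And>j k. \<theta> j k \<in> Ck_space l"
    and A: "\<And>j k i x. i \<le> l \<Longrightarrow> \<bar>c j k * (deriv ^^ i) (\<theta> j k) x\<bar> \<le> A j"
    and summable_A: "summable A"
begin

lemma fin_point: "finite {k. x \<in> supp (\<theta> j k)}"
  using fin[of j x x] by simp

lemma superposition_bound: "i \<le> l \<Longrightarrow> \<bar>level_sum (c j) (\<theta> j) i x\<bar> \<le> N * A j"
  by (rule level_sum_bound[OF fin_point overlap A])

lemma superposition_summable: "i \<le> l \<Longrightarrow> summable (\<lambda>j. level_sum (c j) (\<theta> j) i x)"
  using superposition_bound
  by (intro summable_comparison_test'[OF summable_mult[OF summable_A, of N], of 0]) auto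

lemma superposition_uniform_limit:
  "i \<le> l \<Longrightarrow> uniform_limit UNIV (\<lambda>n x. \<Sum>j<n. level_sum (c j) (\<theta> j) i x)
    (\<lambda>x. \<Sum>j. level_sum (c j) (\<theta> j) i x) sequentially"
  using superposition_bound
  by (intro Weierstrass_m_test[OF _ summable_mult[OF summable_A, of N]]) auto

lemma superposition_continuous:
  assumes "i \<le> l"
  shows "continuous_on UNIV (\<lambda>x. \<Sum>j. level_sum (c j) (\<theta> j) i x)"
  by (rule uniform_limit_theorem[OF _ superposition_uniform_limit[OF assms]])
    (use assms in \<open>auto intro!: always_eventually continuous_on_sum level_sum_continuous[OF fin smooth]\<close>)

lemma superposition_has_derivative:
  assumes "i < l"
  shows "((\<lambda>x. \<Sum>j. level_sum (c j) (\<theta> j) i x) has_field_derivative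
    (\<Sum>j. level_sum (c j) (\<theta> j) (Suc i) x)) (at x)"
proof -
  have "uniform_limit UNIV (\<lambda>n x. \<Sum>j<n. level_sum (c j) (\<theta> j) (Suc i) x)
    (\<lambda>x. \<Sum>j. level_sum (c j) (\<theta> j) (Suc i) x) sequentially"
    using assms by (intro superposition_uniform_limit) auto
  from has_field_derivative_series[OF convex_UNIV
      level_sum_has_derivative[OF fin smooth assms] this UNIV_I superposition_summable[of i 0]] assms
  obtain g where g: "\<And>x. (\<lambda>j. level_sum (c j) (\<theta> j) i x) sums g x"
    "\<And>x. (g has_field_derivative (\<Sum>j. level_sum (c j) (\<theta> j) (Suc i) x)) (at x)"
    by auto
  moreover have "g = (\<lambda>x. \<Sum>j. level_sum (c j) (\<theta> j) i x)"
    using sums_unique[OF g(1)] by auto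
  ultimately show ?thesis by simp
qed

lemma superposition_deriv:
  assumes f: "\<And>x. f x = (\<Sum>j. level_sum (c j) (\<theta> j) 0 x)" and "i \<le> l"
  shows "(deriv ^^ i) f = (\<lambda>x. \<Sum>j. level_sum (c j) (\<theta> j) i x)"
  using \<open>i \<le> l\<close>
proof (induction i)
  case 0
  show ?case using f by auto
next
  case (Suc i)
  then show ?case
    using DERIV_imp_deriv[OF superposition_has_derivative[of i]] by auto
qed

lemma superposition_Ck_space:
  assumes f: "\<And>x. f x = (\<Sum>j. level_sum (c j) (\<theta> j) 0 x)"
  shows "f \<in> Ck_space l"
  unfolding Ck_space_def
  using superposition_continuous[of l] superposition_has_derivative
  by (auto simp: superposition_deriv[OF f] real_differentiable_def)

lemma superposition_holder:
  assumes f: "\<And>x. f x = (\<Sum>j. level_sum (c j) (\<theta> j) 0 x)"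
    and H: "\<And>j k x h. \<bar>c j k * ((deriv ^^ l) (\<theta> j k) (x + h) - (deriv ^^ l) (\<theta> j k) x)\<bar>
      \<le> A j * \<bar>h\<bar> powr \<alpha>"
  shows "\<bar>(deriv ^^ l) f (x + h) - (deriv ^^ l) f x\<bar> \<le> (2 * N * suminf A) * \<bar>h\<bar> powr \<alpha>"
proof -
  let ?T = "\<lambda>j. level_sum (c j) (\<theta> j) l"
  have b: "\<bar>?T j (x + h) - ?T j x\<bar> \<le> 2 * N * \<bar>h\<bar> powr \<alpha> * A j" for j
    using level_sum_difference_bound[OF fin_point overlap H] by (simp add: mult_ac)
  have s: "summable (\<lambda>j. 2 * N * \<bar>h\<bar> powr \<alpha> * A j)" by (intro summable_mult summable_A)
  have s': "summable (\<lambda>j. \<bar>?T j (x + h) - ?T j x\<bar>)"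
    by (rule summable_comparison_test'[OF s, of 0]) (use b in auto)
  have "(deriv ^^ l) f (x + h) - (deriv ^^ l) f x = (\<Sum>j. ?T j (x + h) - ?T j x)"
    by (simp add: superposition_deriv[OF f order_refl] suminf_diff superposition_summable)
  also have "\<bar>\<dots>\<bar> \<le> (\<Sum>j. \<bar>?T j (x + h) - ?T j x\<bar>)" by (rule summable_rabs[OF s'])
  also have "\<dots> \<le> (\<Sum>j. 2 * N * \<bar>h\<bar> powr \<alpha> * A j)" by (rule suminf_le[OF b s' s])
  also have "\<dots> = (2 * N * suminf A) * \<bar>h\<bar> powr \<alpha>"
    unfolding suminf_mult[OF summable_A] by (simp add: mult_ac)
  finally show ?thesis .
qed

end

section \<open>Pointwise reconstruction of a bounded function\<close>

text \<open>Along a cofinal sequence of finite index sets the squared distances tend to 0 in mean, so by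
  Fatou's lemma their pointwise lower limit is 0 almost everywhere. Where the partial sums converge
  to \<open>t\<close>, that lower limit is \<open>(F x - t)\<^sup>2\<close>.\<close>

lemma L2_has_sum_imp_AE_pointwise_limit:
  fixes u :: "'i \<Rightarrow> real \<Rightarrow> real"
  assumes sum: "L2_has_sum u F I"
    and Fs: "filterlim Fs (finite_subsets_at_top I) sequentially"
    and meas: "F \<in> borel_measurable lebesgue"
      "\<And>n i. i \<in> Fs n \<Longrightarrow> u i \<in> borel_measurable lebesgue"
  shows "AE x in lebesgue. \<forall>t. (\<lambda>n. \<Sum>i\<in>Fs n. u i x) \<longlonglongrightarrow> t \<longrightarrow> F x = t"
proof -
  define q where "q = (\<lambda>n x. ennreal ((F x - (\<Sum>i\<in>Fs n. u i x))\<^sup>2))"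
  have q[measurable]: "q n \<in> borel_measurable lebesgue" for n
    unfolding q_def using meas by measurable
  have "(\<lambda>n. \<integral>\<^sup>+x. q n x \<partial>lebesgue) \<longlonglongrightarrow> 0"
    unfolding q_def using filterlim_compose[OF sum[unfolded L2_has_sum_def] Fs] .
  then have "liminf (\<lambda>n. \<integral>\<^sup>+x. q n x \<partial>lebesgue) = 0"
    by (intro lim_imp_Liminf) auto
  moreover have "(\<integral>\<^sup>+x. liminf (\<lambda>n. q n x) \<partial>lebesgue) \<le> liminf (\<lambda>n. \<integral>\<^sup>+x. q n x \<partial>lebesgue)"
    by (rule nn_integral_liminf) (rule q)
  ultimately have "(\<integral>\<^sup>+x. liminf (\<lambda>n. q n x) \<partial>lebesgue) = 0" by simp
  then have "AE x in lebesgue. liminf (\<lambda>n. q n x) = 0"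
    by (subst (asm) nn_integral_0_iff_AE) auto
  then show ?thesis
  proof eventually_elim
    case (elim x)
    show ?case
    proof (intro allI impI)
      fix t assume "(\<lambda>n. \<Sum>i\<in>Fs n. u i x) \<longlonglongrightarrow> t"
      then have "(\<lambda>n. q n x) \<longlonglongrightarrow> ennreal ((F x - t)\<^sup>2)"
        unfolding q_def by (intro tendsto_intros)
      then have "liminf (\<lambda>n. q n x) = ennreal ((F x - t)\<^sup>2)"
        by (intro lim_imp_Liminf) auto
      then show "F x = t" using elim by (simp add: ennreal_eq_0_iff)
    qed
  qed
qed

text \<open>The frame expansion is available for functions in \<open>L\<^sup>2\<close> only, whereas \<open>f\<close> is merely bounded.
  But the expansion is local: an element whose support meets \<open>K = {x0 - 1..x0 + 1}\<close> is supported
  within distance \<open>L\<close> of \<open>K\<close>, so on \<open>K\<close> the expansion of the truncation \<open>ft\<close> of \<open>f\<close> has the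
  coefficients of \<open>f\<close> itself. Comparing \<open>L\<^sup>2\<close>-sums with pointwise sums, first over \<open>k\<close> at each
  scale and then over the scales, gives the formula almost everywhere near \<open>x0\<close>; both sides are
  continuous.\<close>

lemma frame_reconstruction:
  fixes f :: "real \<Rightarrow> real"
  assumes frame: "parseval_frame \<phi> \<psi>"
    and diam: "\<And>j k x y. x \<in> supp (atom \<phi> \<psi> j k) \<Longrightarrow> y \<in> supp (atom \<phi> \<psi> j k) \<Longrightarrow> \<bar>x - y\<bar> \<le> L"
    and fin: "\<And>j a b. finite {k. supp (atom \<phi> \<psi> j k) \<inter> {a..b} \<noteq> {}}"
    and "L \<ge> 0" and cont: "continuous_on UNIV f" and M: "\<And>x. \<bar>f x\<bar> \<le> M"
    and summable: "\<And>x. summable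
      (\<lambda>j. level_sum (\<lambda>k. pairing f (atom \<phi> \<psi> j k)) (atom \<phi> \<psi> j) 0 x)"
    and cont_sum: "continuous_on UNIV
      (\<lambda>x. \<Sum>j. level_sum (\<lambda>k. pairing f (atom \<phi> \<psi> j k)) (atom \<phi> \<psi> j) 0 x)"
  shows "f x0 = (\<Sum>j. level_sum (\<lambda>k. pairing f (atom \<phi> \<psi> j k)) (atom \<phi> \<psi> j) 0 x0)"
proof -
  define T where "T = (\<lambda>j. level_sum (\<lambda>k. pairing f (atom \<phi> \<psi> j k)) (atom \<phi> \<psi> j) 0)"
  define K where "K = {x0 - 1..x0 + 1}"
  define ft where "ft = (\<lambda>x. indicator {x0 - 1 - L..x0 + 1 + L} x * f x)"
  have fm: "f \<in> borel_measurable lebesgue" by (rule continuous_imp_lebesgue_measurable[OF cont])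
  have ftm: "ft \<in> borel_measurable lebesgue"
    unfolding ft_def using fm by (intro borel_measurable_times borel_measurable_indicator) auto
  have "integrable lebesgue (\<lambda>x. (ft x)\<^sup>2)"
  proof (rule Bochner_Integration.integrable_bound)
    show "integrable lebesgue (\<lambda>x. M\<^sup>2 * indicator {x0 - 1 - L..x0 + 1 + L} x)"
      by (intro integrable_mult_right) (auto simp: integrable_indicator_iff emeasure_lborel_Icc_eq)
    show "(\<lambda>x. (ft x)\<^sup>2) \<in> borel_measurable lebesgue"
      using ftm by (rule borel_measurable_power)
    have "(f x)\<^sup>2 \<le> M\<^sup>2" for x using M[of x] by (simp add: abs_le_square_iff[symmetric])
    then show "AE x in lebesgue. norm ((ft x)\<^sup>2) \<le> norm (M\<^sup>2 * indicator {x0 - 1 - L..x0 + 1 + L} x)"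
      by (auto simp: ft_def indicator_def)
  qed
  then have ft: "ft \<in> L2_space" using ftm by (simp add: L2_space_def)
  then obtain g h where g: "g \<in> L2_space" "\<And>j. j \<ge> 1 \<Longrightarrow> h j \<in> L2_space"
    and gsum: "L2_has_sum (\<lambda>k x. pairing ft (\<phi> k) * \<phi> k x) g UNIV"
    and hsum: "\<And>j. j \<ge> 1 \<Longrightarrow> L2_has_sum (\<lambda>k x. pairing ft (\<psi> j k) * \<psi> j k x) (h j) UNIV"
    and ftsum: "L2_has_sum h (\<lambda>x. ft x - g x) {1..}"
    using frame unfolding parseval_frame_def by blast
  have L2_meas: "w \<in> borel_measurable lebesgue" if "w \<in> L2_space" for w
    using that by (simp add: L2_space_def)
  have atom_meas: "atom \<phi> \<psi> j k \<in> borel_measurable lebesgue" for j k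
    using frame by (auto simp: parseval_frame_def atom_def intro!: L2_meas)
  have level: "AE x in lebesgue. x \<in> K \<longrightarrow> G x = T j x"
    if G: "L2_has_sum (\<lambda>k x. pairing ft (atom \<phi> \<psi> j k) * atom \<phi> \<psi> j k x) G UNIV"
      and Gm: "G \<in> borel_measurable lebesgue" for j G
  proof -
    let ?H = "{k. supp (atom \<phi> \<psi> j k) \<inter> K \<noteq> {}}"
    (* The sets ?Fs n eventually contain the finitely many indices active on K, so on K the partial
       sums over them are eventually constant. *)
    let ?Fs = "\<lambda>n. {- int n..int n}"
    have finH: "finite ?H" unfolding K_def by (rule fin)
    have lim: "filterlim ?Fs (finite_subsets_at_top UNIV) sequentially"
      unfolding filterlim_finite_subsets_at_top
    proof (intro allI impI)
      fix X :: "int set" assume "finite X \<and> X \<subseteq> UNIV"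
      then obtain b where b: "\<And>k. k \<in> X \<Longrightarrow> \<bar>k\<bar> \<le> b"
        using finite_imageI[of X abs] bdd_above_finite[of "abs ` X"] by (auto simp: bdd_above_def)
      have "finite (?Fs n) \<and> X \<subseteq> ?Fs n \<and> ?Fs n \<subseteq> UNIV" if "n \<ge> nat b" for n
      proof -
        have "\<bar>k\<bar> \<le> int n" if "k \<in> X" for k using b[OF that] \<open>n \<ge> nat b\<close> by linarith
        then show ?thesis by force
      qed
      then show "\<forall>\<^sub>F n in sequentially. finite (?Fs n) \<and> X \<subseteq> ?Fs n \<and> ?Fs n \<subseteq> UNIV"
        by (rule eventually_sequentiallyI)
    qed
    have "AE x in lebesgue. \<forall>t. (\<lambda>n. \<Sum>k\<in>?Fs n. pairing ft (atom \<phi> \<psi> j k) * atom \<phi> \<psi> j k x)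
        \<longlonglongrightarrow> t \<longrightarrow> G x = t"
      by (rule L2_has_sum_imp_AE_pointwise_limit[OF G lim Gm])
        (intro borel_measurable_times borel_measurable_const atom_meas)
    then show ?thesis
    proof eventually_elim
      case (elim x)
      show ?case
      proof
        assume x: "x \<in> K"
        have same: "pairing ft (atom \<phi> \<psi> j k) = pairing f (atom \<phi> \<psi> j k)" if k: "k \<in> ?H" for k
        proof -
          obtain p where p: "p \<in> supp (atom \<phi> \<psi> j k)" "p \<in> K" using k by auto
          have "ft y * atom \<phi> \<psi> j k y = f y * atom \<phi> \<psi> j k y" for y
          proof (cases "y \<in> supp (atom \<phi> \<psi> j k)")
            case True
            have "y \<in> {x0 - 1 - L..x0 + 1 + L}"
              using diam[OF True p(1)] p(2) by (auto simp: K_def)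
            then show ?thesis by (simp add: ft_def)
          next
            case False
            then show ?thesis using deriv_eq_0_outside_supp[of y _ 0] by simp
          qed
          then show ?thesis by (simp only: pairing_def)
        qed
        have T: "T j x = (\<Sum>k\<in>?H. pairing f (atom \<phi> \<psi> j k) * atom \<phi> \<psi> j k x)"
          unfolding T_def using level_sum_eq_sum_on_interval[where \<theta> = "atom \<phi> \<psi> j" and a = "x0 - 1"
              and b = "x0 + 1" and x = x and i = 0, OF fin] x
          by (simp add: K_def)
        have "\<forall>\<^sub>F n in sequentially. finite (?Fs n) \<and> ?H \<subseteq> ?Fs n \<and> ?Fs n \<subseteq> UNIV"
          using lim finH unfolding filterlim_finite_subsets_at_top by blast
        then have "\<forall>\<^sub>F n in sequentially.
            (\<Sum>k\<in>?Fs n. pairing ft (atom \<phi> \<psi> j k) * atom \<phi> \<psi> j k x) = T j x"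
        proof eventually_elim
          case (elim n)
          have "(\<Sum>k\<in>?H. pairing ft (atom \<phi> \<psi> j k) * atom \<phi> \<psi> j k x)
              = (\<Sum>k\<in>?Fs n. pairing ft (atom \<phi> \<psi> j k) * atom \<phi> \<psi> j k x)"
          proof (rule sum.mono_neutral_left)
            show "\<forall>k\<in>?Fs n - ?H. pairing ft (atom \<phi> \<psi> j k) * atom \<phi> \<psi> j k x = 0"
              using x deriv_eq_0_outside_supp[of x _ 0] by auto
          qed (use elim in auto)
          then show ?case using same by (simp add: T)
        qed
        then have "(\<lambda>n. \<Sum>k\<in>?Fs n. pairing ft (atom \<phi> \<psi> j k) * atom \<phi> \<psi> j k x) \<longlonglongrightarrow> T j x"
          by (rule tendsto_eventually)
        then show "G x = T j x" by (rule elim[rule_format])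
      qed
    qed
  qed
  have "AE x in lebesgue. x \<in> K \<longrightarrow> g x = T 0 x"
    using gsum g L2_meas by (intro level) (auto simp: atom_def)
  moreover have "AE x in lebesgue. \<forall>j. j \<ge> 1 \<longrightarrow> x \<in> K \<longrightarrow> h j x = T j x"
  proof -
    have "AE x in lebesgue. j \<ge> 1 \<longrightarrow> x \<in> K \<longrightarrow> h j x = T j x" for j
    proof (cases "j \<ge> 1")
      case True
      have "AE x in lebesgue. x \<in> K \<longrightarrow> h j x = T j x"
        using hsum[OF True] g(2)[OF True] L2_meas True by (intro level) (auto simp: atom_def)
      then show ?thesis by eventually_elim auto
    qed auto
    then show ?thesis by (simp add: AE_all_countable)
  qed
  moreover have "AE x in lebesgue. \<forall>t. (\<lambda>n. \<Sum>j\<in>{1..n}. h j x) \<longlonglongrightarrow> t \<longrightarrow> ft x - g x = t"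
  proof (rule L2_has_sum_imp_AE_pointwise_limit[OF ftsum])
    show "filterlim (\<lambda>n. {1..n}) (finite_subsets_at_top {1..}) sequentially"
      unfolding filterlim_finite_subsets_at_top
    proof (intro allI impI)
      fix X :: "nat set" assume X: "finite X \<and> X \<subseteq> {1..}"
      then obtain b where b: "\<And>k. k \<in> X \<Longrightarrow> k \<le> b"
        using finite_nat_set_iff_bounded_le[of X] by blast
      have "finite {1..n} \<and> X \<subseteq> {1..n} \<and> {1..n} \<subseteq> {1..}" if "n \<ge> b" for n
      proof -
        have "k \<in> {1..n}" if "k \<in> X" for k
          using b[OF that] \<open>n \<ge> b\<close> X that by auto
        then show ?thesis by auto
      qed
      then show "\<forall>\<^sub>F n in sequentially. finite {1..n} \<and> X \<subseteq> {1..n} \<and> {1..n} \<subseteq> {1..}"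
        by (rule eventually_sequentiallyI)
    qed
  qed (use ftm g L2_meas in auto)
  ultimately have "AE x in lebesgue. x \<in> {x0 - 1<..<x0 + 1} \<longrightarrow> f x = (\<Sum>j. T j x)"
  proof eventually_elim
    case (elim x)
    show ?case
    proof
      assume x: "x \<in> {x0 - 1<..<x0 + 1}"
      then have xK: "x \<in> K" by (auto simp: K_def)
      have "(\<lambda>n. \<Sum>j<n. T j x) \<longlonglongrightarrow> (\<Sum>j. T j x)"
        using summable unfolding T_def by (rule summable_LIMSEQ)
      then have "(\<lambda>n. (\<Sum>j<Suc n. T j x) - T 0 x) \<longlonglongrightarrow> (\<Sum>j. T j x) - T 0 x"
        by (intro tendsto_diff tendsto_const LIMSEQ_Suc)
      moreover have "(\<Sum>j<Suc n. T j x) - T 0 x = (\<Sum>j\<in>{1..n}. h j x)" for n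
      proof -
        have "(\<Sum>j<Suc n. T j x) = T 0 x + (\<Sum>j\<in>{1..n}. T j x)"
          unfolding sum.lessThan_Suc_shift by (simp add: sum.atLeast1_atMost_eq)
        then show ?thesis using elim(2) xK by simp
      qed
      ultimately have "ft x - g x = (\<Sum>j. T j x) - T 0 x" using elim(3) by simp
      then have eq: "ft x = (\<Sum>j. T j x)" using elim(1) xK by simp
      then show "f x = (\<Sum>j. T j x)" using x \<open>L \<ge> 0\<close> by (simp add: ft_def)
    qed
  qed
  then show ?thesis
    unfolding T_def
    by (intro continuous_AE_eq_imp_eq[OF cont cont_sum, of "{x0 - 1<..<x0 + 1}"]) auto
qed

section \<open>The exponent and the decay rate of the coefficients\<close>

lemma bounded_function_coefficient_bound:
  assumes short: "short_supports \<phi> \<psi>" and smooth: "smooth_family s \<phi> \<psi>" and "s > 0"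
    and M: "\<And>x. \<bar>f x\<bar> \<le> M"
  obtains C where "\<And>j k. \<bar>pairing f (atom \<phi> \<psi> j k)\<bar> \<le> C * 2 powr (- (real j / 2))"
proof -
  have M0: "M \<ge> 0" using M[of 0] by linarith
  obtain L where L: "L > 0" "\<And>j k x y. x \<in> supp (atom \<phi> \<psi> j k) \<Longrightarrow>
      y \<in> supp (atom \<phi> \<psi> j k) \<Longrightarrow> \<bar>x - y\<bar> \<le> L * 2 powr (- real j)"
    using atom_supp_diameter[OF short] by blast
  obtain B where B: "B > 0"
    "\<And>j k. Cs_norm 0 (atom \<phi> \<psi> j k) \<le> ennreal (B * 2 powr (real j * (0 + 1/2)))"
    using atom_Cs_norm_bound[OF smooth, of 0] \<open>s > 0\<close> by auto
  have "\<bar>pairing f (atom \<phi> \<psi> j k)\<bar> \<le> 2 * L * M * B * 2 powr (- (real j / 2))" for j k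
  proof -
    have g: "\<bar>atom \<phi> \<psi> j k x\<bar> \<le> B * 2 powr (real j / 2)" for x
      using Cs_norm_leD_deriv[OF _ B(2), of j k 0 x] atom_smooth[OF smooth, of 0 j k] \<open>s > 0\<close> B(1)
      by simp
    have "\<bar>pairing f (atom \<phi> \<psi> j k)\<bar>
        \<le> 2 * (L * 2 powr (- real j)) * (M * (B * 2 powr (real j / 2)))"
      unfolding pairing_def
    proof (rule integral_le_diameter_times_bound[where S = "supp (atom \<phi> \<psi> j k)"])
      show "\<bar>f x * atom \<phi> \<psi> j k x\<bar> \<le> M * (B * 2 powr (real j / 2))" for x
        unfolding abs_mult using M g M0 by (intro mult_mono) auto
      show "f x * atom \<phi> \<psi> j k x = 0" if "x \<notin> supp (atom \<phi> \<psi> j k)" for x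
        using deriv_eq_0_outside_supp[OF that, of 0] by simp
    qed (use L M0 B(1) in auto)
    also have "\<dots> = 2 * L * M * B * (2 powr (- real j) * 2 powr (real j / 2))"
      by simp
    also have "2 powr (- real j) * 2 powr (real j / 2) = 2 powr (- (real j / 2))"
      unfolding powr_add[symmetric] by (rule arg_cong[where f = "\<lambda>t. 2 powr t"]) simp
    finally show ?thesis .
  qed
  then show ?thesis by (rule that)
qed

text \<open>This is the converse half. At scale \<open>j\<close> the coefficients are of order
  \<open>2 powr (- j * (\<sigma> + 1/2))\<close> and the norms of order \<open>r\<close> of the frame elements of order
  \<open>2 powr (j * (r + 1/2))\<close>, so the reconstruction formula is dominated, in all
  derivatives and in the Hoelder seminorm, by a geometric series with ratio \<open>2 powr (r - \<sigma>) < 1\<close>.\<close>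

lemma besov_space_if_coefficients_decay:
  fixes f :: "real \<Rightarrow> real"
  assumes frame: "parseval_frame \<phi> \<psi>" and short: "short_supports \<phi> \<psi>"
    and ovl: "bounded_overlap \<phi> \<psi>" and smooth: "smooth_family s \<phi> \<psi>"
    and cont: "continuous_on UNIV f" and Linf: "f \<in> Linf_space"
    and r: "0 < r" "r \<le> s" "r \<notin> \<nat>" "r < \<sigma>"
    and decay: "\<And>j k. j \<ge> 1 \<Longrightarrow> \<bar>pairing f (\<psi> j k)\<bar> \<le> C * 2 powr (- (real j * (\<sigma> + 1/2)))"
  shows "f \<in> besov_space r"
proof -
  define \<theta> where "\<theta> = atom \<phi> \<psi>"
  define c where "c = (\<lambda>j k. pairing f (\<theta> j k))"
  define l where "l = nat \<lfloor>r\<rfloor>"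
  obtain M where M: "M \<ge> 0" "\<And>x. \<bar>f x\<bar> \<le> M"
    using continuous_Linf_space_imp_bounded[OF cont Linf] by blast
  obtain L where L: "L > 0" "\<And>j k x y. x \<in> supp (\<theta> j k) \<Longrightarrow> y \<in> supp (\<theta> j k) \<Longrightarrow>
      \<bar>x - y\<bar> \<le> L * 2 powr (- real j)"
    using atom_supp_diameter[OF short] unfolding \<theta>_def by blast
  have diam: "\<bar>x - y\<bar> \<le> L" if "x \<in> supp (\<theta> j k)" "y \<in> supp (\<theta> j k)" for j k x y
  proof -
    have "2 powr (- real j) \<le> 2 powr 0" by (intro powr_mono) auto
    then have "L * 2 powr (- real j) \<le> L * 1" using L(1) by (intro mult_left_mono) auto
    then show ?thesis using L(2)[OF that] by linarith
  qed
  obtain B where B: "B > 0" "\<And>j k. Cs_norm r (\<theta> j k) \<le> ennreal (B * 2 powr (real j * (r + 1/2)))"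
    using atom_Cs_norm_bound[OF smooth] r unfolding \<theta>_def by (metis less_imp_le)
  have Ck: "\<theta> j k \<in> Ck_space l" for j k
    unfolding \<theta>_def l_def by (rule atom_smooth[OF smooth r(2)])
  have \<theta>_deriv: "\<bar>(deriv ^^ i) (\<theta> j k) x\<bar> \<le> B * 2 powr (real j * (r + 1/2))" if "i \<le> l" for i j k x
    by (rule Cs_norm_leD_deriv[OF Ck[unfolded l_def] B(2) _ that[unfolded l_def]])
      (use B(1) in simp)
  have \<theta>_holder: "\<bar>(deriv ^^ l) (\<theta> j k) (x + h) - (deriv ^^ l) (\<theta> j k) x\<bar>
      \<le> B * 2 powr (real j * (r + 1/2)) * \<bar>h\<bar> powr frac r" for j k x h
    unfolding l_def by (rule Cs_norm_leD_holder[OF r(3) B(2)]) (use B(1) in simp)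
  obtain N where N: "N > 0" "\<And>K j. is_interval K \<Longrightarrow> bounded K \<Longrightarrow> finite (hits \<phi> \<psi> j K) \<and>
      real (card (hits \<phi> \<psi> j K)) \<le> N * (2 ^ j * measure lborel K + 1)"
    using ovl unfolding bounded_overlap_def by blast
  have hits: "hits \<phi> \<psi> j K = {k. supp (\<theta> j k) \<inter> K \<noteq> {}}" for j K
    unfolding hits_def \<theta>_def atom_def ..
  have fin: "finite {k. supp (\<theta> j k) \<inter> {a..b} \<noteq> {}}" for j a b
    using N(2)[of "{a..b}" j] unfolding hits by (simp add: is_interval_cc)
  have overlap: "real (card {k. x \<in> supp (\<theta> j k)}) \<le> N" for j x
    using N(2)[of "{x}" j] unfolding hits by (simp add: is_interval_1)
  have s0: "s > 0" using r(1,2) by linarith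
  obtain C0 where C0: "\<And>j k. \<bar>pairing f (\<theta> j k)\<bar> \<le> C0 * 2 powr (- (real j / 2))"
    using bounded_function_coefficient_bound[where f = f, OF short smooth s0 M(2), folded \<theta>_def] by blast
  (* C0 handles the elements \<phi> k at scale 0, to which the decay hypothesis does not apply. *)
  define C' where "C' = max C C0"
  have c: "\<bar>c j k\<bar> \<le> C' * 2 powr (- (real j * (\<sigma> + 1/2)))" for j k
  proof (cases "j = 0")
    case True
    have "\<bar>c j k\<bar> \<le> C0" using C0[of j k] True by (simp add: c_def)
    then show ?thesis using True by (simp add: C'_def)
  next
    case False
    then have "\<bar>c j k\<bar> \<le> C * 2 powr (- (real j * (\<sigma> + 1/2)))"
      using decay[of j k] by (simp add: c_def \<theta>_def atom_def)
    also have "\<dots> \<le> C' * 2 powr (- (real j * (\<sigma> + 1/2)))"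
      by (rule mult_right_mono) (auto simp: C'_def)
    finally show ?thesis .
  qed
  define A where "A = (\<lambda>j. C' * B * (2 powr (r - \<sigma>)) ^ j)"
  have cB: "\<bar>c j k\<bar> * (B * 2 powr (real j * (r + 1/2))) \<le> A j" for j k
  proof -
    have "\<bar>c j k\<bar> * (B * 2 powr (real j * (r + 1/2)))
        \<le> C' * 2 powr (- (real j * (\<sigma> + 1/2))) * (B * 2 powr (real j * (r + 1/2)))"
      by (rule mult_right_mono[OF c]) (use B(1) in simp)
    also have "\<dots> = C' * B * (2 powr (- (real j * (\<sigma> + 1/2))) * 2 powr (real j * (r + 1/2)))"
      by simp
    also have "2 powr (- (real j * (\<sigma> + 1/2))) * 2 powr (real j * (r + 1/2)) = 2 powr ((r - \<sigma>) * real j)"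
      unfolding powr_add[symmetric] by (rule arg_cong[where f = "\<lambda>t. 2 powr t"]) (simp add: algebra_simps)
    also have "\<dots> = (2 powr (r - \<sigma>)) ^ j"
      by (simp add: powr_powr[symmetric] powr_realpow)
    finally show ?thesis by (simp add: A_def)
  qed
  have A: "\<bar>c j k * (deriv ^^ i) (\<theta> j k) x\<bar> \<le> A j" if "i \<le> l" for i j k x
    unfolding abs_mult by (rule order_trans[OF mult_left_mono[OF \<theta>_deriv[OF that]] cB]) simp
  have A_holder: "\<bar>c j k * ((deriv ^^ l) (\<theta> j k) (x + h) - (deriv ^^ l) (\<theta> j k) x)\<bar>
      \<le> A j * \<bar>h\<bar> powr frac r" for j k x h
  proof -
    have "\<bar>c j k * ((deriv ^^ l) (\<theta> j k) (x + h) - (deriv ^^ l) (\<theta> j k) x)\<bar>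
        \<le> \<bar>c j k\<bar> * (B * 2 powr (real j * (r + 1/2)) * \<bar>h\<bar> powr frac r)"
      unfolding abs_mult by (rule mult_left_mono[OF \<theta>_holder]) simp
    also have "\<dots> = \<bar>c j k\<bar> * (B * 2 powr (real j * (r + 1/2))) * \<bar>h\<bar> powr frac r"
      by (simp only: mult.assoc)
    also have "\<dots> \<le> A j * \<bar>h\<bar> powr frac r" by (rule mult_right_mono[OF cB]) simp
    finally show ?thesis .
  qed
  have summable_A: "summable A"
    unfolding A_def using r(4) by (intro summable_mult summable_geometric) (simp add: powr_less_one)
  have f: "f x = (\<Sum>j. level_sum (c j) (\<theta> j) 0 x)" for x
    unfolding c_def \<theta>_def
  proof (rule frame_reconstruction[where f = f, OF frame diam[unfolded \<theta>_def] fin[unfolded \<theta>_def] _ cont M(2)])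
    show "summable (\<lambda>j. level_sum (\<lambda>k. pairing f (atom \<phi> \<psi> j k)) (atom \<phi> \<psi> j) 0 x)" for x
      using superposition_summable[OF fin overlap Ck A summable_A, of 0 x]
      by (simp add: c_def \<theta>_def)
    show "continuous_on UNIV
        (\<lambda>x. \<Sum>j. level_sum (\<lambda>k. pairing f (atom \<phi> \<psi> j k)) (atom \<phi> \<psi> j) 0 x)"
      using superposition_continuous[OF fin overlap Ck A summable_A, of 0]
      by (simp add: c_def \<theta>_def)
  qed (use L(1) in auto)
  have "f \<in> Ck_space l"
    by (rule superposition_Ck_space[where f = f, OF fin overlap Ck A summable_A f])
  moreover have "holder_seminorm (frac r) ((deriv ^^ l) f) < \<infinity>"
    by (rule holder_seminorm_finiteI[OF superposition_holder[where f = f, OF fin overlap Ck A summable_A f A_holder]])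
  ultimately show ?thesis
    using Linf r(3) by (simp add: besov_space_def Cs_space_def l_def)
qed

lemma powr_le_if_le_log:
  assumes "x > 0" "y > 0" "\<tau> \<le> log 2 (x / y)"
  shows "y * 2 powr \<tau> \<le> x"
proof -
  have "2 powr \<tau> \<le> 2 powr log 2 (x / y)" using assms(3) by simp
  also have "\<dots> = x / y" using assms(1,2) by simp
  finally show ?thesis using assms(2) by (simp add: pos_le_divide_eq mult.commute)
qed

lemma le_powr_if_log_le:
  assumes "x > 0" "y > 0" "log 2 (x / y) \<le> \<tau>"
  shows "x \<le> y * 2 powr \<tau>"
proof -
  have "x / y = 2 powr log 2 (x / y)" using assms(1,2) by simp
  also have "\<dots> \<le> 2 powr \<tau>" using assms(3) by simp
  finally show ?thesis using assms(2) by (simp add: pos_divide_le_eq mult.commute)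
qed

text \<open>Eventually \<open>a (n + 1) \<le> 2 powr (- \<tau>) * a n\<close>, so \<open>a n * 2 powr (n * \<tau>)\<close> is eventually decreasing.\<close>

lemma log_ratio_limit_imp_upper_bound:
  fixes a :: "nat \<Rightarrow> real"
  assumes pos: "\<forall>\<^sub>F n in sequentially. a n > 0"
    and lim: "(\<lambda>n. log 2 (a n / a (n + 1))) \<longlonglongrightarrow> \<rho>" and "\<tau> < \<rho>"
  obtains C where "\<And>n. a n \<le> C * 2 powr (- (real n * \<tau>))"
proof -
  define b where "b = (\<lambda>n. a n * 2 powr (real n * \<tau>))"
  have "\<forall>\<^sub>F n in sequentially. a n > 0 \<and> log 2 (a n / a (n + 1)) > \<tau>"
    using pos order_tendstoD(1)[OF lim \<open>\<tau> < \<rho>\<close>] by (rule eventually_conj)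
  then obtain J where J: "\<And>n. n \<ge> J \<Longrightarrow> a n > 0" "\<And>n. n \<ge> J \<Longrightarrow> log 2 (a n / a (n + 1)) > \<tau>"
    unfolding eventually_sequentially by blast
  have step: "b (Suc n) \<le> b n" if "n \<ge> J" for n
  proof -
    have "a (Suc n) * 2 powr \<tau> \<le> a n"
      using powr_le_if_le_log[of "a n" "a (n + 1)" \<tau>] J(1)[of n] J(1)[of "n + 1"] J(2)[of n] that
      by simp
    then have "a (Suc n) * 2 powr \<tau> * 2 powr (real n * \<tau>) \<le> b n"
      unfolding b_def by (rule mult_right_mono) simp
    moreover have "b (Suc n) = a (Suc n) * 2 powr \<tau> * 2 powr (real n * \<tau>)"
      by (simp add: b_def powr_add[symmetric] algebra_simps)
    ultimately show ?thesis by simp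
  qed
  have tail: "b n \<le> b J" if "n \<ge> J" for n
    using that by (induction rule: dec_induct) (use step order_trans in blast)+
  have "b n \<le> Max (b ` {..J})" for n
  proof (cases "n \<le> J")
    case False
    then have "b n \<le> b J" by (intro tail) simp
    also have "b J \<le> Max (b ` {..J})" by simp
    finally show ?thesis .
  qed simp
  then have "a n \<le> Max (b ` {..J}) * 2 powr (- (real n * \<tau>))" for n
    using b_def by (simp add: powr_minus field_simps)
  then show ?thesis by (rule that)
qed

text \<open>For \<open>\<mu>\<close> strictly between \<open>\<rho>\<close> and \<open>\<tau>\<close>, the sequence \<open>a n * 2 powr (n * \<tau>)\<close> eventually gains a
  factor of at least \<open>2 powr (\<tau> - \<mu>) > 1\<close> in each step, so it is unbounded.\<close>

lemma log_ratio_limit_imp_no_faster_decay: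
  fixes a :: "nat \<Rightarrow> real"
  assumes pos: "\<forall>\<^sub>F n in sequentially. a n > 0"
    and lim: "(\<lambda>n. log 2 (a n / a (n + 1))) \<longlonglongrightarrow> \<rho>" and "\<rho> < \<tau>"
    and C: "\<And>n. n \<ge> 1 \<Longrightarrow> a n \<le> C * 2 powr (- (real n * \<tau>))"
  shows False
proof -
  define \<mu> where "\<mu> = (\<rho> + \<tau>) / 2"
  have \<mu>: "\<rho> < \<mu>" "\<mu> < \<tau>" using \<open>\<rho> < \<tau>\<close> by (auto simp: \<mu>_def)
  define b where "b = (\<lambda>n. a n * 2 powr (real n * \<tau>))"
  define q where "q = 2 powr (\<tau> - \<mu>)"
  have q: "q > 1" using \<mu> by (simp add: q_def)
  have "\<forall>\<^sub>F n in sequentially. a n > 0 \<and> log 2 (a n / a (n + 1)) < \<mu>"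
    using pos order_tendstoD(2)[OF lim \<mu>(1)] by (rule eventually_conj)
  then obtain J where J: "\<And>n. n \<ge> J \<Longrightarrow> a n > 0" "\<And>n. n \<ge> J \<Longrightarrow> log 2 (a n / a (n + 1)) < \<mu>"
    unfolding eventually_sequentially by blast
  have step: "b n * q \<le> b (Suc n)" if "n \<ge> J" for n
  proof -
    have "a n \<le> a (Suc n) * 2 powr \<mu>"
      using le_powr_if_log_le[of "a n" "a (n + 1)" \<mu>] J(1)[of n] J(1)[of "n + 1"] J(2)[of n] that
      by simp
    then have "a n * (2 powr (real n * \<tau>) * q) \<le> a (Suc n) * 2 powr \<mu> * (2 powr (real n * \<tau>) * q)"
      by (rule mult_right_mono) (simp add: q_def)
    also have "\<dots> = b (Suc n)"
      by (simp add: b_def q_def powr_add[symmetric] algebra_simps)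
    finally show ?thesis by (simp add: b_def mult.assoc)
  qed
  have growth: "b J * q ^ n \<le> b (J + n)" for n
  proof (induction n)
    case (Suc n)
    have "b J * q ^ Suc n = b J * q ^ n * q" by simp
    also have "\<dots> \<le> b (J + n) * q" using Suc q by (intro mult_right_mono) auto
    also have "\<dots> \<le> b (J + Suc n)" using step[of "J + n"] by simp
    finally show ?case .
  qed simp
  have b_le: "b n \<le> C" if "n \<ge> 1" for n
    using C[OF that] by (simp add: b_def powr_minus field_simps)
  have bJ: "b J > 0" using J(1)[of J] by (simp add: b_def)
  obtain n where n: "C / b J < q ^ n" using real_arch_pow[OF q] by blast
  also have "q ^ n \<le> q ^ Suc n" using q by simp
  finally have "C < b J * q ^ Suc n" using bJ by (simp add: field_simps)
  also have "\<dots> \<le> b (J + Suc n)" by (rule growth)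
  also have "\<dots> \<le> C" by (rule b_le) simp
  finally show False by simp
qed

lemma exists_non_natural_between:
  fixes a b :: real
  assumes "a < b"
  obtains r where "a < r" "r < b" "r \<notin> \<nat>"
proof -
  have "countable (\<nat> :: real set)" by (simp add: Nats_def)
  then obtain r where "r \<in> {a<..<b}" "r \<notin> \<nat>"
    using real_interval_avoid_countable_set[OF assms] by blast
  then show ?thesis by (intro that[of r]) simp_all
qed

theorem proposition4p1:
  fixes s :: real and v :: nat
    and \<phi> :: "int \<Rightarrow> real \<Rightarrow> real" and \<psi> :: "nat \<Rightarrow> int \<Rightarrow> real \<Rightarrow> real"
    and f :: "real \<Rightarrow> real" and rstar :: real
  assumes "s > 0" and "v \<ge> 1"
    and "parseval_frame \<phi> \<psi>"
    and "short_supports \<phi> \<psi>"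
    and "bounded_overlap \<phi> \<psi>"
    and "vanishing_moments v \<psi>"
    and "smooth_family s \<phi> \<psi>"
    and "f \<in> Cs_space 0 \<inter> Linf_space"
    and "\<forall>\<^sub>F n in sequentially. coeff_sup \<psi> f n > 0"
    and "(\<lambda>n. log 2 (coeff_sup \<psi> f n / coeff_sup \<psi> f (n + 1)) - 1/2) \<longlonglongrightarrow> rstar"
    and "0 < rstar" and "rstar < min s (real v)"
  shows "ereal rstar = holder_zygmund_exponent f"
proof -
  let ?\<gamma> = "coeff_sup \<psi> f"
  have cont: "continuous_on UNIV f" and Linf: "f \<in> Linf_space"
    using assms(8) by (auto simp: Cs_space_def Ck_space_def)
  obtain M where M: "M \<ge> 0" "\<And>x. \<bar>f x\<bar> \<le> M"
    using continuous_Linf_space_imp_bounded[OF cont Linf] by blast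
  have lim: "(\<lambda>n. log 2 (?\<gamma> n / ?\<gamma> (n + 1))) \<longlonglongrightarrow> rstar + 1/2"
    using tendsto_add[OF assms(10) tendsto_const[of "1/2"]] by simp
  have upper: "r \<le> rstar" if "r > 0" and f: "f \<in> besov_space r" for r
  proof (rule ccontr)
    assume "\<not> r \<le> rstar"
    then have "rstar < min r (real v)" using assms(12) by simp
    (* \<rho> < v keeps the Taylor degree within the vanishing moments; excluding naturals leaves a
       positive Hoelder exponent frac \<rho>. *)
    then obtain \<rho> where \<rho>: "rstar < \<rho>" "\<rho> < min r (real v)" "\<rho> \<notin> \<nat>"
      by (rule exists_non_natural_between)
    define m where "m = nat \<lfloor>\<rho>\<rfloor>"
    have \<rho>_eq: "\<rho> = real m + frac \<rho>" using \<rho>(1) assms(11) by (simp add: m_def frac_def)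
    have "frac \<rho> \<noteq> 0"
    proof
      assume "frac \<rho> = 0"
      then have "\<rho> = real m" using \<rho>_eq by linarith
      then show False using \<rho>(3) by simp
    qed
    then have \<beta>: "0 < frac \<rho>" "frac \<rho> < 1" using frac_ge_0[of \<rho>] frac_lt_1[of \<rho>] by linarith+
    have mr: "real m + frac \<rho> < r" and mv: "m < v" using \<rho> \<rho>_eq \<beta> by linarith+
    obtain K where K: "K \<ge> 0"
      "\<And>x h. \<bar>(deriv ^^ m) f (x + h) - (deriv ^^ m) f x\<bar> \<le> K * \<bar>h\<bar> powr frac \<rho>"
      using besov_space_imp_holder(2)[OF f cont \<beta> mr] by blast
    obtain C where C: "\<And>j k. j \<ge> 1 \<Longrightarrow>
        \<bar>pairing f (\<psi> j k)\<bar> \<le> C * 2 powr (- (real j * (real m + frac \<rho> + 1/2)))"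
      using coefficient_decay[OF assms(4,6,7,1) besov_space_imp_holder(1)[OF f cont \<beta> mr] mv \<beta>(1) K M(2)]
      by blast
    have "?\<gamma> j \<le> C * 2 powr (- (real j * (\<rho> + 1/2)))" if "j \<ge> 1" for j
      unfolding coeff_sup_def by (rule cSUP_least) (use C[OF that] \<rho>_eq in auto)
    then show False
      using log_ratio_limit_imp_no_faster_decay[OF assms(9) lim, of "\<rho> + 1/2" C] \<rho>(1) by auto
  qed
  obtain C0 where C0: "\<And>j k. \<bar>pairing f (atom \<phi> \<psi> j k)\<bar> \<le> C0 * 2 powr (- (real j / 2))"
    using bounded_function_coefficient_bound[where f = f, OF assms(4,7,1) M(2)] by blast
  (* The supremum in coeff_sup bounds its members only because the coefficients of each scale are
     bounded. *)
  have coeff_le: "\<bar>pairing f (\<psi> j k)\<bar> \<le> ?\<gamma> j" if "j \<ge> 1" for j k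
  proof -
    have "\<bar>pairing f (\<psi> j k)\<bar> \<le> C0 * 2 powr (- (real j / 2))" for k
      using C0[of j k] that by (simp add: atom_def)
    then have "bdd_above (range (\<lambda>k. \<bar>pairing f (\<psi> j k)\<bar>))"
      by (rule bdd_aboveI2)
    then show ?thesis unfolding coeff_sup_def by (intro cSUP_upper UNIV_I)
  qed
  have lower: "f \<in> besov_space r" if r: "0 < r" "r < rstar" "r \<notin> \<nat>" for r
  proof -
    define \<sigma> where "\<sigma> = (r + rstar) / 2"
    have \<sigma>: "r < \<sigma>" "\<sigma> < rstar" using r by (auto simp: \<sigma>_def)
    obtain C where C: "\<And>n. ?\<gamma> n \<le> C * 2 powr (- (real n * (\<sigma> + 1/2)))"
      using log_ratio_limit_imp_upper_bound[OF assms(9) lim, of "\<sigma> + 1/2"] \<sigma> by auto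
    show ?thesis
      by (rule besov_space_if_coefficients_decay[where f = f, OF assms(3,4,5,7) cont Linf r(1) _ r(3) \<sigma>(1)
            order_trans[OF coeff_le C]]) (use r assms(12) in auto)
  qed
  show ?thesis
  proof (rule antisym)
    show "holder_zygmund_exponent f \<le> ereal rstar"
      unfolding holder_zygmund_exponent_def by (rule SUP_least) (use upper in auto)
    show "ereal rstar \<le> holder_zygmund_exponent f"
    proof (rule ccontr)
      assume "\<not> ereal rstar \<le> holder_zygmund_exponent f"
      (* The maximum with 0 makes the intermediate order positive. *)
      then have "max 0 (holder_zygmund_exponent f) < ereal rstar" using assms(11) by simp
      then obtain z where z: "max 0 (holder_zygmund_exponent f) < ereal z" "z < rstar"
        using ereal_dense2 by fastforce
      obtain r where r: "z < r" "r < rstar" "r \<notin> \<nat>"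
        using exists_non_natural_between[OF z(2)] by blast
      have "0 < r" using z(1) r(1) by (auto simp: zero_ereal_def)
      then have "ereal r \<le> holder_zygmund_exponent f"
        unfolding holder_zygmund_exponent_def using lower[OF _ r(2,3)] by (intro SUP_upper) auto
      also have "\<dots> < ereal z" using z(1) by simp
      finally show False using r(1) by simp
    qed
  qed
qed

end
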